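(* Let $(E,\phi)$ be a $t$-module of dimension $d$ over $K$, and let $D\in \mathrm{Mat}_{d\times d}(K\{\tau\})\subseteq \mathrm{Mat}_{d\times d}(K(\!(\sigma)\!))$ be the matrix representing $\phi_t$ with respect to a fixed coordinate system. Let $\lambda_d\in K(\!(\sigma)\!)[t]$ be the last invariant factor of $D$. Then the following are equivalent: (1) $E$ is abelian; (2) $E$ is $t$-finite; (3) the Newton polygon of $\lambda_d$ has positive slopes only.
   Context: Let $\mathbb{F}_q$ be the finite field with $q$ elements, $K$ a perfect field containing $\mathbb{F}_q$, and $\ell:\mathbb{F}_q[t]\to K$ an $\mathbb{F}_q$-algebra homomorphism. $K\{\tau\}$ denotes the skew polynomial ring $\{\sum_{i=0}^n\alpha_i\tau^i : \alpha_i\in K\}$ with multiplication determined by $\tau\alpha=\alpha^q\tau$ ($\alpha\in K$); it is identified with the ring of $\mathbb{F}_q$-linear group-scheme endomorphisms of the additive group $\mathbb{G}_a$ over $K$ ($\tau$ = $q$-th power Frobenius, $\alpha$ = scalar multiplication). $K(\!(\sigma)\!)$ denotes the skew field of Laurent series $\sum_{i\ge i_0}\alpha_i\sigma^i$ ($\alpha_i\in K$) with $\sigma\alpha=\alpha^{1/q}\sigma$; it carries the discrete valuation $v$ = order in $\sigma$, with valuation ring $K[\![\sigma]\!]$. $K\{\tau\}$ embeds in $K(\!(\sigma)\!)$ via $\tau\mapsto\sigma^{-1}$. A $t$-module $(E,\phi)$ of dimension $d$ over $K$ is an $\mathbb{F}_q$-vector space scheme $E$ over $K$ isomorphic to $\mathbb{G}_a^d$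 together with an $\mathbb{F}_q$-algebra homomorphism $\phi:\mathbb{F}_q[t]\to\mathrm{End}_{\mathrm{grp},\mathbb{F}_q}(E)$ such that for every $a$, $d\phi_a-\ell(a)$ is nilpotent on $\mathrm{Lie}(E)$. After fixing an isomorphism (coordinate system) $E\cong\mathbb{G}_a^d$ over $K$, each $\phi_a$ is given by a matrix in $\mathrm{Mat}_{d\times d}(K\{\tau\})$ acting on column vectors. The $t$-motive of $E$ is $\mathsf{M}(E)=\mathrm{Hom}_{\mathrm{grp},\mathbb{F}_q}(E,\mathbb{G}_a)$, a $K[t]$-module via post-composition with scalars of $K$ and pre-composition with $\phi_t$; $E$ is called abelian if $\mathsf{M}(E)$ is finitely generated as a $K[t]$-module. The dual $t$-motive is $\check{\mathsf{M}}(E)=\mathrm{Hom}_{\mathrm{grp},\mathbb{F}_q}(\mathbb{G}_a,E)$, a $K[t]$-module via pre-composition with scalar multiplication on $\mathbb{G}_a$ and post-composition with $\phi_t$; $E$ is called $t$-finite if $\check{\mathsf{M}}(E)$ is finitely generated as a $K[t]$-module. Invariant factors: $t$ is a central indeterminate over $K(\!(\sigma)\!)$. By elementary row and column operations over $K(\!(\sigma)\!)[t]$ the matrix $t\mathbf{1}_d-D$ can be brought into diagonal form $\mathrm{diag}(\lambda_1,\dots,\lambda_d)$ with monic $\lambda_i$ such that each $\lambda_i$ is both a left and a right divisor of $\lambda_{i+1}$; these $\lambda_i$ are the invariant factors of $D$ (unique up to similarity; the valuations of their coefficients, hence their Newton polygons, do not depend on the choice). Newton polygon: for $f=\sum_{i=0}^n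 a_it^i$ with coefficients in $K(\!(\sigma)\!)$, its Newton polygon is the lower convex hull of the points $(i,v(a_i))$ with $a_i\neq0$; the slope of an edge from $(i,w_i)$ to $(j,w_j)$ is $(w_j-w_i)/(j-i)$. "The Newton polygon of $f$ has positive slopes only" is understood to include that the constant coefficient $a_0$ is non-zero. *)

theory Defs
  imports Complex_Main "HOL-Computational_Algebra.Polynomial"
begin

definition is_Fq_subfield :: "'k::field set \<Rightarrow> nat \<Rightarrow> bool" where
  "is_Fq_subfield F q \<longleftrightarrow> finite F \<and> card F = q \<and> 0 \<in> F \<and> 1 \<in> F \<and>
     (\<forall>x\<in>F. \<forall>y\<in>F. x + y \<in> F \<and> x * y \<in> F) \<and>
     (\<forall>x\<in>F. - x \<in> F \<and> inverse x \<in> F)"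

definition perfect_field :: "'k::field itself \<Rightarrow> bool" where
  "perfect_field _ \<longleftrightarrow> CHAR('k) = 0 \<or> surj (\<lambda>x::'k. x ^ CHAR('k))"

text \<open>q-Frobenius and its integer powers: frz q n x = x^(q^n), negative n via the inverse
  (which exists since K is perfect).\<close>
definition frobq :: "nat \<Rightarrow> 'k::field \<Rightarrow> 'k" where
  "frobq q x = x ^ q"

definition frz :: "nat \<Rightarrow> int \<Rightarrow> 'k::field \<Rightarrow> 'k" where
  "frz q n = (if 0 \<le> n then (frobq q ^^ nat n) else (inv (frobq q) ^^ nat (- n)))"

section \<open>Skew polynomials K{tau} (represented by coefficient polynomials)\<close>

text \<open>(sum a_i tau^i)(sum b_j tau^j) = sum a_i b_j^(q^i) tau^(i+j)\<close>
definition skmult :: "nat \<Rightarrow> 'k::field poly \<Rightarrow> 'k poly \<Rightarrow> 'k poly" where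
  "skmult q a b = Poly (map (\<lambda>n. \<Sum>i\<le>n. coeff a i * (coeff b (n - i)) ^ (q ^ i))
                          [0..<degree a + degree b + 1])"

text \<open>d x d matrices over K{tau} as functions, entries outside {..<d} are junk (required 0).\<close>
type_synonym 'k skmat = "nat \<Rightarrow> nat \<Rightarrow> 'k poly"

definition skmat_mult :: "nat \<Rightarrow> nat \<Rightarrow> 'k::field skmat \<Rightarrow> 'k skmat \<Rightarrow> 'k skmat" where
  "skmat_mult q d A B = (\<lambda>i j. if i < d \<and> j < d then (\<Sum>k<d. skmult q (A i k) (B k j)) else 0)"

definition skmat_one :: "nat \<Rightarrow> 'k::field skmat" where
  "skmat_one d = (\<lambda>i j. if i < d \<and> i = j then 1 else 0)"

definition skmat_pow :: "nat \<Rightarrow> nat \<Rightarrow> 'k::field skmat \<Rightarrow> nat \<Rightarrow> 'k skmat" where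
  "skmat_pow q d A n = ((\<lambda>B. skmat_mult q d A B) ^^ n) (skmat_one d)"

text \<open>phi_a = a(D) for a in F_q[t] (scalars of F_q are central in K{tau}).\<close>
definition phi_of :: "nat \<Rightarrow> nat \<Rightarrow> 'k::field skmat \<Rightarrow> 'k poly \<Rightarrow> 'k skmat" where
  "phi_of q d D a = (\<lambda>i j. \<Sum>n\<le>degree a. smult (coeff a n) (skmat_pow q d D n i j))"

text \<open>Matrices over K and the differential (action on Lie(E) = constant terms).\<close>
type_synonym 'k kmat = "nat \<Rightarrow> nat \<Rightarrow> 'k"

definition kmat_mult :: "nat \<Rightarrow> 'k::field kmat \<Rightarrow> 'k kmat \<Rightarrow> 'k kmat" where
  "kmat_mult d A B = (\<lambda>i j. if i < d \<and> j < d then (\<Sum>k<d. A i k * B k j) else 0)"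

definition kmat_one :: "nat \<Rightarrow> 'k::field kmat" where
  "kmat_one d = (\<lambda>i j. if i < d \<and> i = j then 1 else 0)"

definition kmat_pow :: "nat \<Rightarrow> 'k::field kmat \<Rightarrow> nat \<Rightarrow> 'k kmat" where
  "kmat_pow d A n = ((\<lambda>B. kmat_mult d A B) ^^ n) (kmat_one d)"

definition kmat_nilpotent :: "nat \<Rightarrow> 'k::field kmat \<Rightarrow> bool" where
  "kmat_nilpotent d A \<longleftrightarrow> (\<exists>N. \<forall>i<d. \<forall>j<d. kmat_pow d A N i j = 0)"

definition dmat :: "nat \<Rightarrow> 'k::field skmat \<Rightarrow> 'k kmat" where
  "dmat d A = (\<lambda>i j. if i < d \<and> j < d then coeff (A i j) 0 else 0)"

text \<open>A t-module of dimension d over K in a fixed coordinate system E = G_a^d: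
  phi_t = D in Mat_d(K{tau}); ell(a) = a(theta) with theta = ell(t);
  for every a in F_q[t], d phi_a - ell(a) is nilpotent on Lie(E) = K^d.\<close>
definition is_t_module :: "'k::field set \<Rightarrow> nat \<Rightarrow> 'k \<Rightarrow> nat \<Rightarrow> 'k skmat \<Rightarrow> bool" where
  "is_t_module F q \<theta> d D \<longleftrightarrow>
     (\<forall>i j. (d \<le> i \<or> d \<le> j) \<longrightarrow> D i j = 0) \<and>
     (\<forall>a::'k poly. (\<forall>n. coeff a n \<in> F) \<longrightarrow>
        kmat_nilpotent d (\<lambda>i j. dmat d (phi_of q d D a) i j -
                                 (if i < d \<and> i = j then poly a \<theta> else 0)))"

type_synonym 'k skvec = "nat \<Rightarrow> 'k poly"

definition vec_supp :: "nat \<Rightarrow> 'k::field skvec \<Rightarrow> bool" where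
  "vec_supp d m \<longleftrightarrow> (\<forall>k\<ge>d. m k = 0)"

text \<open>M(E): row vectors m; c.m = c o m (left multiplication), t.m = m o phi_t = m D.\<close>
definition row_times :: "nat \<Rightarrow> nat \<Rightarrow> 'k::field skvec \<Rightarrow> 'k skmat \<Rightarrow> 'k skvec" where
  "row_times q d m D = (\<lambda>j. if j < d then (\<Sum>k<d. skmult q (m k) (D k j)) else 0)"

definition motive_act :: "nat \<Rightarrow> nat \<Rightarrow> 'k::field skmat \<Rightarrow> 'k poly \<Rightarrow> 'k skvec \<Rightarrow> 'k skvec" where
  "motive_act q d D f m = (\<lambda>j. \<Sum>n\<le>degree f.
      skmult q [:coeff f n:] (((\<lambda>v. row_times q d v D) ^^ n) m j))"

text \<open>dual M(E): column vectors m; c.m = m o c (right multiplication), t.m = phi_t o m = D m.\<close>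
definition mat_times :: "nat \<Rightarrow> nat \<Rightarrow> 'k::field skmat \<Rightarrow> 'k skvec \<Rightarrow> 'k skvec" where
  "mat_times q d D m = (\<lambda>i. if i < d then (\<Sum>k<d. skmult q (D i k) (m k)) else 0)"

definition dual_motive_act :: "nat \<Rightarrow> nat \<Rightarrow> 'k::field skmat \<Rightarrow> 'k poly \<Rightarrow> 'k skvec \<Rightarrow> 'k skvec" where
  "dual_motive_act q d D f m = (\<lambda>i. \<Sum>n\<le>degree f.
      skmult q (((\<lambda>v. mat_times q d D v) ^^ n) m i) [:coeff f n:])"

definition fin_gen_K_t :: "nat \<Rightarrow> ('k::field poly \<Rightarrow> 'k skvec \<Rightarrow> 'k skvec) \<Rightarrow> bool" where
  "fin_gen_K_t d act \<longleftrightarrow> (\<exists>gs. (\<forall>g\<in>set gs. vec_supp d g) \<and>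
     (\<forall>m. vec_supp d m \<longrightarrow> (\<exists>fs. length fs = length gs \<and>
        m = (\<lambda>j. \<Sum>k<length gs. act (fs ! k) (gs ! k) j))))"

definition abelian :: "nat \<Rightarrow> nat \<Rightarrow> 'k::field skmat \<Rightarrow> bool" where
  "abelian q d D \<longleftrightarrow> fin_gen_K_t d (motive_act q d D)"

definition t_finite :: "nat \<Rightarrow> nat \<Rightarrow> 'k::field skmat \<Rightarrow> bool" where
  "t_finite q d D \<longleftrightarrow> fin_gen_K_t d (dual_motive_act q d D)"

section \<open>Skew Laurent series K((sigma)), sigma a = a^(1/q) sigma\<close>

type_synonym 'k ls = "int \<Rightarrow> 'k"

definition ls_valid :: "'k::field ls \<Rightarrow> bool" where
  "ls_valid a \<longleftrightarrow> (\<exists>N. \<forall>i<N. a i = 0)"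

definition ls_zero :: "'k::field ls" where "ls_zero = (\<lambda>_. 0)"
definition ls_one :: "'k::field ls" where "ls_one = (\<lambda>i. if i = 0 then 1 else 0)"
definition ls_add :: "'k::field ls \<Rightarrow> 'k ls \<Rightarrow> 'k ls" where "ls_add a b = (\<lambda>i. a i + b i)"
definition ls_neg :: "'k::field ls \<Rightarrow> 'k ls" where "ls_neg a = (\<lambda>i. - a i)"

text \<open>(a sigma^i)(b sigma^j) = a b^(q^(-i)) sigma^(i+j)\<close>
definition ls_mult :: "nat \<Rightarrow> 'k::field ls \<Rightarrow> 'k ls \<Rightarrow> 'k ls" where
  "ls_mult q a b = (\<lambda>k. \<Sum>i\<in>{i. a i \<noteq> 0 \<and> b (k - i) \<noteq> 0}. a i * frz q (- i) (b (k - i)))"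

definition ls_val :: "'k::field ls \<Rightarrow> int" where
  "ls_val a = (LEAST i. a i \<noteq> 0)"

text \<open>embedding K{tau} -> K((sigma)), tau \<mapsto> sigma^(-1)\<close>
definition ls_emb :: "'k::field poly \<Rightarrow> 'k ls" where
  "ls_emb p = (\<lambda>k. if k \<le> 0 then coeff p (nat (- k)) else 0)"

section \<open>Polynomials in a central variable t over K((sigma))\<close>

type_synonym 'k lp = "nat \<Rightarrow> 'k ls"

definition lp_valid :: "'k::field lp \<Rightarrow> bool" where
  "lp_valid f \<longleftrightarrow> finite {n. f n \<noteq> ls_zero} \<and> (\<forall>n. ls_valid (f n))"

definition lp_zero :: "'k::field lp" where "lp_zero = (\<lambda>_. ls_zero)"
definition lp_const :: "'k::field ls \<Rightarrow> 'k lp" where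
  "lp_const c = (\<lambda>n. if n = 0 then c else ls_zero)"
definition lp_X :: "'k::field lp" where
  "lp_X = (\<lambda>n. if n = 1 then ls_one else ls_zero)"
definition lp_add :: "'k::field lp \<Rightarrow> 'k lp \<Rightarrow> 'k lp" where
  "lp_add f g = (\<lambda>n. ls_add (f n) (g n))"
definition lp_sub :: "'k::field lp \<Rightarrow> 'k lp \<Rightarrow> 'k lp" where
  "lp_sub f g = (\<lambda>n. ls_add (f n) (ls_neg (g n)))"
definition lp_mult :: "nat \<Rightarrow> 'k::field lp \<Rightarrow> 'k lp \<Rightarrow> 'k lp" where
  "lp_mult q f g = (\<lambda>n k. \<Sum>i\<le>n. ls_mult q (f i) (g (n - i)) k)"

definition lp_monic :: "'k::field lp \<Rightarrow> bool" where
  "lp_monic f \<longleftrightarrow> lp_valid f \<and> (\<exists>n. f n = ls_one \<and> (\<forall>m>n. f m = ls_zero))"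

definition lp_left_dvd :: "nat \<Rightarrow> 'k::field lp \<Rightarrow> 'k lp \<Rightarrow> bool" where
  "lp_left_dvd q f g \<longleftrightarrow> (\<exists>h. lp_valid h \<and> g = lp_mult q f h)"

definition lp_right_dvd :: "nat \<Rightarrow> 'k::field lp \<Rightarrow> 'k lp \<Rightarrow> bool" where
  "lp_right_dvd q f g \<longleftrightarrow> (\<exists>h. lp_valid h \<and> g = lp_mult q h f)"

type_synonym 'k lpmat = "nat \<Rightarrow> nat \<Rightarrow> 'k lp"

definition char_mat :: "nat \<Rightarrow> 'k::field skmat \<Rightarrow> 'k lpmat" where
  "char_mat d D = (\<lambda>a b. if a < d \<and> b < d then
      lp_sub (if a = b then lp_X else lp_zero) (lp_const (ls_emb (D a b))) else lp_zero)"

inductive elem_reach :: "nat \<Rightarrow> nat \<Rightarrow> 'k::field lpmat \<Rightarrow> 'k lpmat \<Rightarrow> bool"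
  for q :: nat and d :: nat and A :: "'k lpmat" where
  refl: "elem_reach q d A A"
| row_swap: "elem_reach q d A B \<Longrightarrow> i < d \<Longrightarrow> j < d \<Longrightarrow>
    elem_reach q d A (\<lambda>a b. if a = i then B j b else if a = j then B i b else B a b)"
| row_add: "elem_reach q d A B \<Longrightarrow> i < d \<Longrightarrow> j < d \<Longrightarrow> i \<noteq> j \<Longrightarrow> lp_valid r \<Longrightarrow>
    elem_reach q d A (\<lambda>a b. if a = i then lp_add (B i b) (lp_mult q r (B j b)) else B a b)"
| row_scale: "elem_reach q d A B \<Longrightarrow> i < d \<Longrightarrow> ls_valid c \<Longrightarrow> c \<noteq> ls_zero \<Longrightarrow>
    elem_reach q d A (\<lambda>a b. if a = i then lp_mult q (lp_const c) (B i b) else B a b)"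
| col_swap: "elem_reach q d A B \<Longrightarrow> i < d \<Longrightarrow> j < d \<Longrightarrow>
    elem_reach q d A (\<lambda>a b. if b = i then B a j else if b = j then B a i else B a b)"
| col_add: "elem_reach q d A B \<Longrightarrow> i < d \<Longrightarrow> j < d \<Longrightarrow> i \<noteq> j \<Longrightarrow> lp_valid r \<Longrightarrow>
    elem_reach q d A (\<lambda>a b. if b = i then lp_add (B a i) (lp_mult q (B a j) r) else B a b)"
| col_scale: "elem_reach q d A B \<Longrightarrow> i < d \<Longrightarrow> ls_valid c \<Longrightarrow> c \<noteq> ls_zero \<Longrightarrow>
    elem_reach q d A (\<lambda>a b. if b = i then lp_mult q (B a i) (lp_const c) else B a b)"

definition last_invariant_factor :: "nat \<Rightarrow> nat \<Rightarrow> 'k::field skmat \<Rightarrow> 'k lp \<Rightarrow> bool" where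
  "last_invariant_factor q d D lam \<longleftrightarrow>
     (\<exists>B \<Lambda>. elem_reach q d (char_mat d D) B \<and>
        (\<forall>a<d. \<forall>b<d. B a b = (if a = b then \<Lambda> a else lp_zero)) \<and>
        (\<forall>i<d. lp_monic (\<Lambda> i)) \<and>
        (\<forall>i. i + 1 < d \<longrightarrow> lp_left_dvd q (\<Lambda> i) (\<Lambda> (i + 1)) \<and>
                           lp_right_dvd q (\<Lambda> i) (\<Lambda> (i + 1))) \<and>
        lam = \<Lambda> (d - 1))"

definition lp_degree :: "'k::field lp \<Rightarrow> nat" where
  "lp_degree f = (GREATEST n. f n \<noteq> ls_zero)"

text \<open>Lower convex hull of the points (i, v(a_i)), a_i \<noteq> 0, as a function on [0, deg f].\<close>
definition newton_polygon :: "'k::field lp \<Rightarrow> real \<Rightarrow> real" where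
  "newton_polygon f x = Inf {\<Sum>i\<in>{i. i \<le> lp_degree f \<and> f i \<noteq> ls_zero}. c i * real_of_int (ls_val (f i)) | c.
      (\<forall>i. c i \<ge> 0) \<and>
      (\<Sum>i\<in>{i. i \<le> lp_degree f \<and> f i \<noteq> ls_zero}. c i) = 1 \<and>
      (\<Sum>i\<in>{i. i \<le> lp_degree f \<and> f i \<noteq> ls_zero}. c i * real i) = x}"

text \<open>All edges have positive slope (i.e. the polygon is strictly increasing on [0, deg f]),
  including that the constant coefficient is non-zero.\<close>
definition NP_positive_slopes :: "'k::field lp \<Rightarrow> bool" where
  "NP_positive_slopes f \<longleftrightarrow> f 0 \<noteq> ls_zero \<and>
     strict_mono_on {0..real (lp_degree f)} (newton_polygon f)"

end

theory Submission
  imports Defs "HOL-Library.Function_Algebras" "HOL-Computational_Algebra.Formal_Power_Series"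
    "HOL-Algebra.Sylow"
begin

text \<open>
  Let \<open>L = K((\<sigma>))\<close>. Each of the conditions (1) and (2) is equivalent to a contraction property: (1)
  to \<open>1 = \<Sum> B\<^sub>n D\<^sup>n\<close>, and (2) to \<open>1 = \<Sum> D\<^sup>n B\<^sub>n\<close>, a finite sum with matrices \<open>B\<^sub>n\<close> over
  \<open>\<sigma>K[[\<sigma>]]\<close>. Given such a sum, a row \<open>m\<close> over \<open>K{\<tau>}\<close> equals
  \<open>\<Sum> (m B\<^sub>n) D\<^sup>n\<close>; replacing each \<open>m B\<^sub>n\<close> by its polynomial part, which has smaller degree
  than \<open>m\<close>, leaves a remainder of bounded degree, so that rows of bounded degree generate.
  Conversely, if finitely many rows of degree at most \<open>c\<close> generate, then writing
  \<open>\<tau>\<^sup>c\<^sup>+\<^sup>1 e\<^sub>i\<close> in terms of them and multiplying by \<open>\<sigma>\<^sup>c\<^sup>+\<^sup>1\<close> gives the sum.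

  By division by \<open>t - D\<close>, the contraction property says that \<open>X (t - D) \<equiv> 1\<close> modulo \<open>\<sigma>\<close> for
  some matrix \<open>X\<close> over \<open>L[t]\<close>. Powers of \<open>1 - X (t - D)\<close> make the congruence hold modulo any
  power of \<open>\<sigma>\<close>, hence it is invariant under \<open>t - D \<mapsto> P (t - D) Q\<close> with invertible \<open>P\<close>, \<open>Q\<close>,
  and may be tested on the diagonal form, where it reads \<open>x \<lambda>\<^sub>d \<equiv> 1\<close> for some \<open>x\<close> in \<open>L[t]\<close>. By
  Gauss' lemma this means that the constant coefficient of \<open>\<lambda>\<^sub>d\<close> has smaller valuation
  than all the others, a condition that is symmetric in left and right and describes the slopes of
  the Newton polygon.
\<close>
section \<open>Noncommutative rings given by a multiplication parameter\<close>

text \<open>The product is a locale parameter and not a type class operation, so that one additive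
  group can carry several products: the skew one depending on \<open>q\<close>, its opposite, and
  those of polynomials and matrices.\<close>

locale nring =
  fixes mul :: "'a::ab_group_add \<Rightarrow> 'a \<Rightarrow> 'a" (infixl "\<odot>" 70)
    and unit :: 'a
  assumes mul_assoc: "(a \<odot> b) \<odot> c = a \<odot> (b \<odot> c)"
    and add_mul: "(a + b) \<odot> c = a \<odot> c + b \<odot> c"
    and mul_add: "a \<odot> (b + c) = a \<odot> b + a \<odot> c"
    and unit_mul [simp]: "unit \<odot> a = a"
    and mul_unit [simp]: "a \<odot> unit = a"
begin

lemma zero_mul [simp]: "0 \<odot> a = 0"
  using add_mul[of 0 0 a] by simp

lemma mul_zero [simp]: "a \<odot> 0 = 0"
  using mul_add[of a 0 0] by simp

lemma uminus_mul: "(- a) \<odot> b = - (a \<odot> b)"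
  using add_mul[of a "- a" b] by (simp add: eq_neg_iff_add_eq_0 add.commute)

lemma mul_uminus: "a \<odot> (- b) = - (a \<odot> b)"
  using mul_add[of a b "- b"] by (simp add: eq_neg_iff_add_eq_0 add.commute)

lemma diff_mul: "(a - b) \<odot> c = a \<odot> c - b \<odot> c"
  using add_mul[of a "- b" c] by (simp add: uminus_mul)

lemma mul_diff: "a \<odot> (b - c) = a \<odot> b - a \<odot> c"
  using mul_add[of a b "- c"] by (simp add: mul_uminus)

lemma sum_mul: "(\<Sum>i\<in>I. f i) \<odot> a = (\<Sum>i\<in>I. f i \<odot> a)"
  by (induction I rule: infinite_finite_induct) (auto simp: add_mul)

lemma mul_sum: "a \<odot> (\<Sum>i\<in>I. f i) = (\<Sum>i\<in>I. a \<odot> f i)"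
  by (induction I rule: infinite_finite_induct) (auto simp: mul_add)

text \<open>Lets statements on rows be reused for columns: the dual motive is treated as a motive
  over the opposite ring.\<close>

lemma opposite_nring: "nring (\<lambda>a b. b \<odot> a) unit"
  by unfold_locales (auto simp: mul_assoc add_mul mul_add)

section \<open>Polynomials in a central variable, and square matrices\<close>

definition pmul :: "'a poly \<Rightarrow> 'a poly \<Rightarrow> 'a poly" where
  "pmul f g = Poly (map (\<lambda>n. \<Sum>i\<le>n. coeff f i \<odot> coeff g (n - i)) [0..<degree f + degree g + 1])"

lemma coeff_pmul: "coeff (pmul f g) n = (\<Sum>i\<le>n. coeff f i \<odot> coeff g (n - i))"
proof (cases "n < degree f + degree g + 1")
  case True
  then show ?thesis by (simp add: pmul_def coeff_Poly_eq nth_default_def del: upt_Suc)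
next
  case False
  have "coeff f i \<odot> coeff g (n - i) = 0" if "i \<le> n" for i
    using False that by (cases "i \<le> degree f") (simp_all add: coeff_eq_0)
  then show ?thesis using False
    by (simp add: pmul_def coeff_Poly_eq nth_default_def del: upt_Suc)
qed

lemma poly_nring: "nring pmul [:unit:]"
proof
  fix a b c :: "'a poly"
  show "pmul (pmul a b) c = pmul a (pmul b c)"
  proof (rule poly_eqI)
    fix n
    have "coeff (pmul (pmul a b) c) n
        = (\<Sum>j=0..n. \<Sum>i=0..j. coeff a i \<odot> coeff b (j - i) \<odot> coeff c (n - j))"
      by (simp add: coeff_pmul sum_mul atLeast0AtMost)
    also have "\<dots> = (\<Sum>j=0..n. \<Sum>i=0..n - j. coeff a j \<odot> coeff b i \<odot> coeff c (n - j - i))"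
      \<comment> \<open>The rearrangement of the triangular sum known from power series holds for
        arbitrary summands and needs no commutativity.\<close>
      by (rule fps_mult_assoc_lemma)
    finally show "coeff (pmul (pmul a b) c) n = coeff (pmul a (pmul b c)) n"
      by (simp add: coeff_pmul mul_sum atLeast0AtMost mul_assoc)
  qed
next
  fix a :: "'a poly"
  have "(\<Sum>i\<le>n. coeff [:unit:] i \<odot> coeff a (n - i)) = (\<Sum>i\<in>{0}. coeff [:unit:] i \<odot> coeff a (n - i))" for n
    by (rule sum.mono_neutral_right) (auto simp: coeff_pCons split: nat.splits)
  then show "pmul [:unit:] a = a"
    by (intro poly_eqI) (simp add: coeff_pmul)
  have "(\<Sum>i\<le>n. coeff a i \<odot> coeff [:unit:] (n - i)) = (\<Sum>i\<in>{n}. coeff a i \<odot> coeff [:unit:] (n - i))" for n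
    by (rule sum.mono_neutral_right) (auto simp: coeff_pCons split: nat.splits)
  then show "pmul a [:unit:] = a"
    by (intro poly_eqI) (simp add: coeff_pmul)
qed (simp_all add: poly_eq_iff coeff_pmul add_mul mul_add sum.distrib)

text \<open>Outside the block of indices below \<open>d\<close> the product is taken entrywise, with all entries of
  the unit equal to \<open>unit\<close>. This makes the type of all functions a unital ring, so that no
  carrier sets are needed.\<close>

definition mm :: "nat \<Rightarrow> (nat \<Rightarrow> nat \<Rightarrow> 'a) \<Rightarrow> (nat \<Rightarrow> nat \<Rightarrow> 'a) \<Rightarrow> nat \<Rightarrow> nat \<Rightarrow> 'a" where
  "mm d A B = (\<lambda>i j. if i < d \<and> j < d then (\<Sum>k<d. A i k \<odot> B k j) else A i j \<odot> B i j)"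

definition mone :: "nat \<Rightarrow> nat \<Rightarrow> nat \<Rightarrow> 'a" where
  "mone d = (\<lambda>i j. if i < d \<and> j < d \<and> i \<noteq> j then 0 else unit)"

lemma sum_delta_mul:
  "i < d \<Longrightarrow> (\<Sum>k<d. (if k = i then x else 0) \<odot> f k) = x \<odot> f (i::nat)"
  "i < d \<Longrightarrow> (\<Sum>k<d. (if i = k then x else 0) \<odot> f k) = x \<odot> f i"
  "i < d \<Longrightarrow> (\<Sum>k<d. f k \<odot> (if k = i then x else 0)) = f i \<odot> x"
  "i < d \<Longrightarrow> (\<Sum>k<d. f k \<odot> (if i = k then x else 0)) = f i \<odot> x"
  by (simp_all add: if_distrib[of "\<lambda>x. x \<odot> _"] if_distrib[of "\<lambda>x. _ \<odot> x"] cong: if_cong)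

lemma mat_nring: "nring (mm d) (mone d)"
proof
  fix A B C :: "nat \<Rightarrow> nat \<Rightarrow> 'a"
  show "mm d (mm d A B) C = mm d A (mm d B C)"
  proof (intro ext)
    fix i j
    show "mm d (mm d A B) C i j = mm d A (mm d B C) i j"
    proof (cases "i < d \<and> j < d")
      case True
      have "mm d (mm d A B) C i j = (\<Sum>k<d. \<Sum>l<d. A i l \<odot> (B l k \<odot> C k j))"
        using True by (simp add: mm_def sum_mul mul_assoc)
      also have "\<dots> = (\<Sum>l<d. \<Sum>k<d. A i l \<odot> (B l k \<odot> C k j))"
        by (rule sum.swap)
      also have "\<dots> = mm d A (mm d B C) i j"
        using True by (simp add: mm_def mul_sum)
      finally show ?thesis .
    next
      case False
      then have "mm d X Y i j = X i j \<odot> Y i j" for X Y by (auto simp: mm_def)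
      then show ?thesis by (simp add: mul_assoc)
    qed
  qed
next
  fix A :: "nat \<Rightarrow> nat \<Rightarrow> 'a"
  have "mm d (mone d) A i j = A i j" for i j
  proof (cases "i < d \<and> j < d")
    case True
    have "mm d (mone d) A i j = (\<Sum>k<d. (if i = k then unit else 0) \<odot> A k j)"
      using True by (auto simp: mm_def mone_def intro!: sum.cong)
    with True show ?thesis by (simp add: sum_delta_mul)
  qed (auto simp: mm_def mone_def)
  then show "mm d (mone d) A = A" by blast
  have "mm d A (mone d) i j = A i j" for i j
  proof (cases "i < d \<and> j < d")
    case True
    have "mm d A (mone d) i j = (\<Sum>k<d. A i k \<odot> (if k = j then unit else 0))"
      using True by (auto simp: mm_def mone_def intro!: sum.cong)
    with True show ?thesis by (simp add: sum_delta_mul)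
  qed (auto simp: mm_def mone_def)
  then show "mm d A (mone d) = A" by blast
qed (auto simp: mm_def fun_eq_iff add_mul mul_add sum.distrib)

section \<open>Invertible elements and two-sided equivalence\<close>

definition invertible :: "'a \<Rightarrow> bool" where
  "invertible P \<longleftrightarrow> (\<exists>P'. P \<odot> P' = unit \<and> P' \<odot> P = unit)"

lemma invertible_unit [simp]: "invertible unit"
  by (auto simp: invertible_def intro!: exI[of _ unit])

lemma invertible_mul:
  assumes "invertible P" "invertible Q"
  shows "invertible (P \<odot> Q)"
proof -
  obtain P' Q' where *: "P \<odot> P' = unit" "P' \<odot> P = unit" "Q \<odot> Q' = unit" "Q' \<odot> Q = unit"
    using assms by (auto simp: invertible_def)
  have "P \<odot> Q \<odot> (Q' \<odot> P') = P \<odot> (Q \<odot> Q') \<odot> P'" "Q' \<odot> P' \<odot> (P \<odot> Q) = Q' \<odot> (P' \<odot> P) \<odot> Q"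
    by (simp_all only: mul_assoc)
  then have "P \<odot> Q \<odot> (Q' \<odot> P') = unit" "Q' \<odot> P' \<odot> (P \<odot> Q) = unit"
    by (simp_all add: *)
  then show ?thesis unfolding invertible_def by blast
qed

definition equivalent :: "'a \<Rightarrow> 'a \<Rightarrow> bool" where
  "equivalent A B \<longleftrightarrow> (\<exists>P Q. invertible P \<and> invertible Q \<and> B = P \<odot> A \<odot> Q)"

lemma equivalent_refl: "equivalent A A"
  unfolding equivalent_def by (rule exI[of _ unit], rule exI[of _ unit]) simp

lemma equivalent_left:
  assumes "equivalent A B" "invertible P"
  shows "equivalent A (P \<odot> B)"
proof -
  obtain P' Q' where "invertible P'" "invertible Q'" "B = P' \<odot> A \<odot> Q'"
    using assms by (auto simp: equivalent_def)
  then have "invertible (P \<odot> P')" "invertible Q'" "P \<odot> B = P \<odot> P' \<odot> A \<odot> Q'"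
    using assms by (auto simp: mul_assoc intro: invertible_mul)
  then show ?thesis unfolding equivalent_def by blast
qed

lemma equivalent_right:
  assumes "equivalent A B" "invertible Q"
  shows "equivalent A (B \<odot> Q)"
proof -
  obtain P' Q' where "invertible P'" "invertible Q'" "B = P' \<odot> A \<odot> Q'"
    using assms by (auto simp: equivalent_def)
  then have "invertible P'" "invertible (Q' \<odot> Q)" "B \<odot> Q = P' \<odot> A \<odot> (Q' \<odot> Q)"
    using assms by (auto simp: mul_assoc intro: invertible_mul)
  then show ?thesis unfolding equivalent_def by blast
qed

lemma equivalent_sym:
  assumes "equivalent A B"
  shows "equivalent B A"
proof -
  obtain P P' Q Q' where *: "P \<odot> P' = unit" "P' \<odot> P = unit" "Q \<odot> Q' = unit" "Q' \<odot> Q = unit"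
    and B: "B = P \<odot> A \<odot> Q"
    using assms by (auto simp: equivalent_def invertible_def)
  have "P' \<odot> B \<odot> Q' = (P' \<odot> P) \<odot> A \<odot> (Q \<odot> Q')"
    by (simp only: B mul_assoc)
  then have "A = P' \<odot> B \<odot> Q'" using * by simp
  then show ?thesis unfolding equivalent_def invertible_def using * by blast
qed

end

text \<open>\<open>fil n\<close> stands for valuation at least \<open>n\<close>. A filtration
  compatible with products is asked for instead of a valuation because it passes to polynomials and
  to matrices, where products of nonzero elements may vanish.\<close>

locale fring = nring +
  fixes fil :: "int \<Rightarrow> 'a \<Rightarrow> bool"
  assumes fil_zero [simp]: "fil n 0"
    and fil_add: "fil n a \<Longrightarrow> fil n b \<Longrightarrow> fil n (a + b)"
    and fil_uminus: "fil n a \<Longrightarrow> fil n (- a)"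
    and fil_mono: "fil n a \<Longrightarrow> m \<le> n \<Longrightarrow> fil m a"
    and fil_mul: "fil m a \<Longrightarrow> fil n b \<Longrightarrow> fil (m + n) (a \<odot> b)"
    and fil_ex: "\<exists>n. fil n a"
begin

lemma fil_diff: "fil n a \<Longrightarrow> fil n b \<Longrightarrow> fil n (a - b)"
  using fil_add[of n a "- b"] fil_uminus[of n b] by simp

lemma fil_sum: "(\<And>i. i \<in> I \<Longrightarrow> fil n (f i)) \<Longrightarrow> fil n (\<Sum>i\<in>I. f i)"
  by (induction I rule: infinite_finite_induct) (auto intro: fil_add)

lemma fil_ex_common:
  assumes "finite I"
  shows "\<exists>n. n \<le> n0 \<and> (\<forall>i\<in>I. fil n (f i))"
  using assms
proof (induction I)
  case (insert x I)
  obtain n where n: "n \<le> n0" "\<forall>i\<in>I. fil n (f i)" using insert.IH by blast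
  obtain m where m: "fil m (f x)" using fil_ex by blast
  show ?case using n m by (intro exI[of _ "min m n"]) (auto intro: fil_mono)
qed auto

lemma opposite_fring: "fring (\<lambda>a b. b \<odot> a) unit fil"
  by (intro fring.intro opposite_nring fring_axioms.intro fil_zero fil_add fil_uminus fil_ex)
    (auto intro: fil_mono simp: add.commute dest: fil_mul)

text \<open>This is the filtration of the Gauss valuation. A lower bound exists because a polynomial
  has finitely many nonzero coefficients.\<close>

lemma poly_fring: "fring pmul [:unit:] (\<lambda>n f. \<forall>i. fil n (coeff f i))"
proof (intro fring.intro poly_nring fring_axioms.intro)
  fix f :: "'a poly"
  obtain n where n: "\<forall>i\<in>{..degree f}. fil n (coeff f i)"
    using fil_ex_common[of "{..degree f}" 0 "coeff f"] by auto
  then have "fil n (coeff f i)" for i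
    by (cases "i \<le> degree f") (auto simp: coeff_eq_0)
  then show "\<exists>n. \<forall>i. fil n (coeff f i)" by blast
qed (auto simp: coeff_pmul intro: fil_add fil_uminus fil_mono intro!: fil_sum fil_mul)

definition mfil :: "nat \<Rightarrow> int \<Rightarrow> (nat \<Rightarrow> nat \<Rightarrow> 'a) \<Rightarrow> bool" where
  "mfil d n A \<longleftrightarrow> (\<forall>i<d. \<forall>j<d. fil n (A i j))"

lemma mat_fring: "fring (mm d) (mone d) (mfil d)"
proof (intro fring.intro mat_nring fring_axioms.intro)
  fix A :: "nat \<Rightarrow> nat \<Rightarrow> 'a"
  obtain n where "\<forall>i\<in>{..<d} \<times> {..<d}. fil n (A (fst i) (snd i))"
    using fil_ex_common[of "{..<d} \<times> {..<d}" 0 "\<lambda>i. A (fst i) (snd i)"] by auto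
  then show "\<exists>n. mfil d n A" by (auto simp: mfil_def)
qed (auto simp: mfil_def mm_def intro: fil_add fil_uminus fil_mono intro!: fil_sum fil_mul)

text \<open>A left inverse up to an error of positive valuation. Neither \<open>A\<close> nor
  \<open>X\<close> has to be integral, so this is not invertibility in a residue ring.\<close>

definition good :: "'a \<Rightarrow> bool" where
  "good A \<longleftrightarrow> (\<exists>X. fil 1 (unit - X \<odot> A))"

text \<open>A product of two errors \<open>unit - X \<odot> A\<close> and
  \<open>unit - Y \<odot> A\<close> is again of the form \<open>unit - Z \<odot> A\<close>, and the
  valuations add up.\<close>

lemma good_power:
  assumes "good A"
  shows "\<exists>X. fil (1 + int n) (unit - X \<odot> A)"
proof (induction n)
  case 0
  then show ?case using assms by (simp add: good_def)
next
  case (Suc n)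
  obtain X where X: "fil (1 + int n) (unit - X \<odot> A)" using Suc.IH by blast
  obtain Y where Y: "fil 1 (unit - Y \<odot> A)" using assms by (auto simp: good_def)
  have "fil (1 + int n + 1) ((unit - X \<odot> A) \<odot> (unit - Y \<odot> A))"
    using X Y by (rule fil_mul)
  also have "(unit - X \<odot> A) \<odot> (unit - Y \<odot> A) = unit - (X + (unit - X \<odot> A) \<odot> Y) \<odot> A"
    by (simp add: mul_diff diff_mul add_mul mul_assoc)
  finally show ?case by (intro exI) (simp add: algebra_simps)
qed

text \<open>Passing to \<open>B\<close> multiplies the error by \<open>Q'\<close> and
  \<open>Q\<close>, which may lower its valuation by a fixed amount. \<open>good_power\<close>
  provides enough precision beforehand to absorb that loss.\<close>

lemma good_equivalent:
  assumes "equivalent A B" "good A"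
  shows "good B"
proof -
  obtain P P' Q Q' where *: "P' \<odot> P = unit" "Q' \<odot> Q = unit" and B: "B = P \<odot> A \<odot> Q"
    using assms by (auto simp: equivalent_def invertible_def)
  obtain m n where mn: "fil m Q'" "fil n Q" using fil_ex by blast
  obtain X where X: "fil (1 + int (nat (- m - n))) (unit - X \<odot> A)"
    using good_power[OF assms(2)] by blast
  have "Q' \<odot> X \<odot> P' \<odot> B = Q' \<odot> (X \<odot> ((P' \<odot> P) \<odot> (A \<odot> Q)))"
    by (simp only: B mul_assoc)
  then have "unit - (Q' \<odot> X \<odot> P') \<odot> B = Q' \<odot> (unit - X \<odot> A) \<odot> Q"
    by (simp add: * mul_diff diff_mul mul_assoc)
  moreover have "fil (m + (1 + int (nat (- m - n))) + n) (Q' \<odot> (unit - X \<odot> A) \<odot> Q)"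
    using X mn by (intro fil_mul)
  ultimately have "fil 1 (unit - (Q' \<odot> X \<odot> P') \<odot> B)"
    by (auto elim!: fil_mono)
  then show ?thesis unfolding good_def by blast
qed

end

section \<open>Elementary matrices and rows\<close>

context nring
begin

text \<open>Here and in the next two definitions the entries outside the block agree with those of
  \<open>mone\<close>, so that invertibility for \<open>mm\<close> is decided inside the
  block.\<close>

definition diagm :: "nat \<Rightarrow> (nat \<Rightarrow> 'a) \<Rightarrow> nat \<Rightarrow> nat \<Rightarrow> 'a" where
  "diagm d c = (\<lambda>a b. if a < d \<and> b < d then (if a = b then c a else 0) else unit)"

definition involm :: "nat \<Rightarrow> (nat \<Rightarrow> nat) \<Rightarrow> nat \<Rightarrow> nat \<Rightarrow> 'a" where
  "involm d s = (\<lambda>a b. if a < d \<and> b < d then (if b = s a then unit else 0) else unit)"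

definition addm :: "nat \<Rightarrow> nat \<Rightarrow> nat \<Rightarrow> 'a \<Rightarrow> nat \<Rightarrow> nat \<Rightarrow> 'a" where
  "addm d i j r = (\<lambda>a b. if a = i \<and> b = j then r else mone d a b)"

lemma mm_inside: "i < d \<Longrightarrow> j < d \<Longrightarrow> mm d A B i j = (\<Sum>k<d. A i k \<odot> B k j)"
  by (simp add: mm_def)

lemma mm_outside: "\<not> (i < d \<and> j < d) \<Longrightarrow> mm d A B i j = A i j \<odot> B i j"
  unfolding mm_def by (simp only: if_False)

lemma mm_diagm: "a < d \<Longrightarrow> b < d \<Longrightarrow> mm d (diagm d c) M a b = c a \<odot> M a b"
proof -
  assume *: "a < d" "b < d"
  then have "mm d (diagm d c) M a b = (\<Sum>k<d. (if a = k then c a else 0) \<odot> M k b)"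
    by (simp add: mm_inside diagm_def)
  with * show ?thesis by (simp add: sum_delta_mul)
qed

lemma mm_diagm_right: "a < d \<Longrightarrow> b < d \<Longrightarrow> mm d M (diagm d c) a b = M a b \<odot> c b"
proof -
  assume *: "a < d" "b < d"
  then have "mm d M (diagm d c) a b = (\<Sum>k<d. M a k \<odot> (if k = b then c b else 0))"
    by (auto simp add: mm_inside diagm_def intro!: sum.cong)
  with * show ?thesis by (simp add: sum_delta_mul)
qed

lemma mm_involm: "(\<And>a. a < d \<Longrightarrow> s a < d) \<Longrightarrow> a < d \<Longrightarrow> b < d \<Longrightarrow> mm d (involm d s) M a b = M (s a) b"
proof -
  assume *: "\<And>a. a < d \<Longrightarrow> s a < d" "a < d" "b < d"
  then have "mm d (involm d s) M a b = (\<Sum>k<d. (if k = s a then unit else 0) \<odot> M k b)"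
    by (simp add: mm_inside involm_def)
  with * show ?thesis by (simp add: sum_delta_mul)
qed

lemma mm_involm_right:
  assumes "\<And>a. a < d \<Longrightarrow> s a < d" "\<And>a. s (s a) = a" "a < d" "b < d"
  shows "mm d M (involm d s) a b = M a (s b)"
proof -
  have "b = s k \<longleftrightarrow> k = s b" for k using assms(2) by metis
  with assms have "mm d M (involm d s) a b = (\<Sum>k<d. M a k \<odot> (if k = s b then unit else 0))"
    by (simp add: mm_inside involm_def)
  with assms show ?thesis by (simp add: sum_delta_mul)
qed

lemma mm_addm:
  assumes "i < d" "j < d" "i \<noteq> j" "a < d" "b < d"
  shows "mm d (addm d i j r) M a b = (if a = i then M i b + r \<odot> M j b else M a b)"
proof -
  have "mm d (addm d i j r) M a b
      = (\<Sum>k<d. (if a = k then unit else 0) \<odot> M k b + (if k = j then (if a = i then r else 0) else 0) \<odot> M k b)"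
    using assms by (auto simp: mm_inside addm_def mone_def intro!: sum.cong)
  with assms show ?thesis by (simp add: sum.distrib sum_delta_mul)
qed

lemma mm_addm_right:
  assumes "i < d" "j < d" "i \<noteq> j" "a < d" "b < d"
  shows "mm d M (addm d i j r) a b = (if b = j then M a j + M a i \<odot> r else M a b)"
proof -
  have "mm d M (addm d i j r) a b
      = (\<Sum>k<d. M a k \<odot> (if k = b then unit else 0) + M a k \<odot> (if k = i then (if b = j then r else 0) else 0))"
    using assms by (auto simp: mm_inside addm_def mone_def intro!: sum.cong)
  with assms show ?thesis by (simp add: sum.distrib sum_delta_mul)
qed

lemma mat_eqI:
  assumes "\<And>a b. a < d \<Longrightarrow> b < d \<Longrightarrow> A a b = B a b"
    and "\<And>a b. \<not> (a < d \<and> b < d) \<Longrightarrow> A a b = B a b"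
  shows "A = B"
  using assms by (metis ext)

lemma invertible_diagm:
  assumes "\<And>a. a < d \<Longrightarrow> invertible (c a)"
  shows "nring.invertible (mm d) (mone d) (diagm d c)"
proof -
  interpret mat: nring "mm d" "mone d" by (rule mat_nring)
  obtain c' where c': "\<And>a. a < d \<Longrightarrow> c a \<odot> c' a = unit \<and> c' a \<odot> c a = unit"
    using assms unfolding invertible_def by metis
  have "mm d (diagm d c) (diagm d c') = mone d"
    using c' by (intro mat_eqI[of d]) (simp_all add: mm_diagm mm_outside, auto simp: diagm_def mone_def)
  moreover have "mm d (diagm d c') (diagm d c) = mone d"
    using c' by (intro mat_eqI[of d]) (simp_all add: mm_diagm mm_outside, auto simp: diagm_def mone_def)
  ultimately show ?thesis unfolding mat.invertible_def by blast
qed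

text \<open>The permutation matrix of an involution is its own inverse.\<close>

lemma invertible_involm:
  assumes "\<And>a. a < d \<Longrightarrow> s a < d" "\<And>a. s (s a) = a"
  shows "nring.invertible (mm d) (mone d) (involm d s)"
proof -
  interpret mat: nring "mm d" "mone d" by (rule mat_nring)
  have "mm d (involm d s) (involm d s) = mone d"
    using assms by (intro mat_eqI[of d]) (simp_all add: mm_involm mm_outside, auto simp: involm_def mone_def)
  then show ?thesis unfolding mat.invertible_def by blast
qed

lemma invertible_addm:
  assumes "i < d" "j < d" "i \<noteq> j"
  shows "nring.invertible (mm d) (mone d) (addm d i j r)"
proof -
  interpret mat: nring "mm d" "mone d" by (rule mat_nring)
  have "mm d (addm d i j r) (addm d i j (- r)) = mone d" for r
    using assms by (intro mat_eqI[of d]) (simp_all add: mm_addm mm_outside, auto simp: addm_def mone_def)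
  from this[of r] this[of "- r"] show ?thesis unfolding mat.invertible_def by auto
qed

text \<open>The row \<open>v\<close> times the matrix \<open>D\<close>. Over the opposite ring, and
  with \<open>D\<close> transposed, the same formula is the matrix times a column.\<close>

definition rt :: "nat \<Rightarrow> (nat \<Rightarrow> nat \<Rightarrow> 'a) \<Rightarrow> (nat \<Rightarrow> 'a) \<Rightarrow> nat \<Rightarrow> 'a" where
  "rt d D v = (\<lambda>j. if j < d then (\<Sum>k<d. v k \<odot> D k j) else 0)"

definition unit_row :: "nat \<Rightarrow> nat \<Rightarrow> 'a" where
  "unit_row i = (\<lambda>j. if j = i then unit else 0)"

definition lscale :: "'a \<Rightarrow> (nat \<Rightarrow> 'a) \<Rightarrow> nat \<Rightarrow> 'a" where
  "lscale c v = (\<lambda>j. c \<odot> v j)"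

lemma rt_pow_add: "(rt d D ^^ n) (v + w) = (rt d D ^^ n) v + (rt d D ^^ n) w"
proof (induction n)
  case (Suc n)
  then show ?case by (simp add: rt_def fun_eq_iff add_mul sum.distrib)
qed simp

lemma rt_pow_zero [simp]: "(rt d D ^^ n) 0 = 0"
  using rt_pow_add[of n d D 0 0] by simp

lemma rt_pow_uminus: "(rt d D ^^ n) (- v) = - (rt d D ^^ n) v"
  using rt_pow_add[of n d D v "- v"] by (simp add: eq_neg_iff_add_eq_0 add.commute)

lemma rt_pow_diff: "(rt d D ^^ n) (v - w) = (rt d D ^^ n) v - (rt d D ^^ n) w"
  using rt_pow_add[of n d D v "- w"] by (simp add: rt_pow_uminus)

lemma rt_pow_sum: "(rt d D ^^ n) (\<Sum>i\<in>I. f i) = (\<Sum>i\<in>I. (rt d D ^^ n) (f i))"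
  using sum_comp_morphism[of "rt d D ^^ n" f I, OF rt_pow_zero rt_pow_add] by (simp add: o_def)

lemma rt_pow_lscale: "(rt d D ^^ n) (lscale c v) = lscale c ((rt d D ^^ n) v)"
proof (induction n)
  case (Suc n)
  then show ?case by (simp add: rt_def lscale_def fun_eq_iff mul_sum mul_assoc)
qed simp

lemma lscale_add: "lscale c (v + w) = lscale c v + lscale c w"
  by (simp add: lscale_def fun_eq_iff mul_add)

lemma lscale_zero [simp]: "lscale c 0 = 0"
  by (simp add: lscale_def fun_eq_iff)

lemma lscale_sum: "lscale c (\<Sum>i\<in>I. f i) = (\<Sum>i\<in>I. lscale c (f i))"
  using sum_comp_morphism[of "lscale c" f I, OF lscale_zero lscale_add] by (simp add: o_def)

lemma lscale_lscale: "lscale a (lscale b v) = lscale (a \<odot> b) v"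
  by (simp add: lscale_def mul_assoc)

lemma sum_apply: "(\<Sum>i\<in>I. f i) x = (\<Sum>i\<in>I. f i (x :: 'b) :: 'c :: ab_group_add)"
  by (induction I rule: infinite_finite_induct) auto

lemma lscale_sum_left: "lscale (\<Sum>i\<in>I. c i) v = (\<Sum>i\<in>I. lscale (c i) v)"
  unfolding fun_eq_iff sum_apply by (simp add: lscale_def sum_mul)

lemma row_expand:
  assumes "\<And>j. d \<le> j \<Longrightarrow> v j = 0"
  shows "v = (\<Sum>i<d. lscale (v i) (unit_row i))"
proof
  fix j
  have "(\<Sum>i<d. lscale (v i) (unit_row i)) j = (\<Sum>i<d. if j = i then v j else 0)"
    unfolding sum_apply lscale_def unit_row_def by (intro sum.cong) auto
  then show "v j = (\<Sum>i<d. lscale (v i) (unit_row i)) j"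
    using assms[of j] by (cases "j < d") auto
qed

text \<open>The matrix \<open>t - D\<close> over the polynomial ring.\<close>

definition charm :: "(nat \<Rightarrow> nat \<Rightarrow> 'a) \<Rightarrow> nat \<Rightarrow> nat \<Rightarrow> 'a poly" where
  "charm D = (\<lambda>i j. [:- D i j, if i = j then unit else 0:])"

end

section \<open>Contraction and division by \<open>t - D\<close>\<close>

context fring
begin

definition row_fil :: "int \<Rightarrow> (nat \<Rightarrow> 'a) \<Rightarrow> bool" where
  "row_fil n v \<longleftrightarrow> (\<forall>j. fil n (v j))"

text \<open>Row by row, the identity matrix is a sum of matrices \<open>B n * D ^ n\<close>, with all
  entries of the \<open>B n\<close> of positive valuation.\<close>
definition contracting :: "nat \<Rightarrow> (nat \<Rightarrow> nat \<Rightarrow> 'a) \<Rightarrow> bool" where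
  "contracting d D \<longleftrightarrow> (\<exists>N B. (\<forall>n i. row_fil 1 (B n i) \<and> (\<forall>j\<ge>d. B n i j = 0)) \<and>
     (\<forall>i<d. unit_row i = (\<Sum>n\<le>N. (rt d D ^^ n) (B n i))))"

text \<open>With coefficients on the left, substituting \<open>D\<close> for \<open>t\<close> from
  the right sends a matrix polynomial to 0 exactly if it is a left multiple of \<open>t - D\<close>.
  Hence \<open>\<Sum> B n * D ^ n = 1\<close> means that
  \<open>\<Sum> B n * t ^ n = 1 - X (t - D)\<close> for some \<open>X\<close>, and positivity of all
  \<open>B n\<close> is the condition on the error.\<close>

lemma contracting_iff_good:
  "contracting d D \<longleftrightarrow> fring.good (nring.mm pmul d) (nring.mone [:unit:] d)
     (fring.mfil (\<lambda>n f. \<forall>i. fil n (coeff f i)) d) (charm D)" (is "_ \<longleftrightarrow> ?good")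
proof -
  interpret pol: fring pmul "[:unit:]" "\<lambda>n f. \<forall>i. fil n (coeff f i)" by (rule poly_fring)
  interpret mat: fring "pol.mm d" "pol.mone d" "pol.mfil d" by (rule pol.mat_fring)
  have coeff_charm: "coeff (pol.mm d X (charm D) i j) n
      = (if n = 0 then 0 else coeff (X i j) (n - 1)) - rt d D (\<lambda>k. coeff (X i k) n) j"
    if "i < d" "j < d" for X i j n
  proof -
    have "coeff (pmul f [:a, b:]) n = coeff f n \<odot> a + (if n = 0 then 0 else coeff f (n - 1) \<odot> b)" for f a b
    proof (cases n)
      case 0
      then show ?thesis by (simp add: coeff_pmul)
    next
      case (Suc m)
      have "coeff (pmul f [:a, b:]) n = (\<Sum>i\<in>{m, n}. coeff f i \<odot> coeff [:a, b:] (n - i))"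
        unfolding coeff_pmul
        by (rule sum.mono_neutral_right) (auto simp: coeff_pCons Suc split: nat.splits)
      then show ?thesis by (simp add: Suc add.commute)
    qed
    then have "coeff (pol.mm d X (charm D) i j) n
       = (\<Sum>k<d. (if n = 0 then 0 else coeff (X i k) (n - 1)) \<odot> (if k = j then unit else 0)
                   - coeff (X i k) n \<odot> D k j)"
      using that by (auto simp: pol.mm_inside charm_def coeff_sum mul_uminus intro!: sum.cong)
    then show ?thesis using that by (simp add: sum_subtractf rt_def sum_delta_mul)
  qed
  have coeff_mone: "coeff (pol.mone d i j) n = (if n = 0 then unit_row i j else 0)" if "i < d" "j < d" for i j n
    using that by (auto simp: pol.mone_def unit_row_def coeff_pCons split: nat.splits)
  show ?thesis
  proof
    assume ?good
    then obtain X where "pol.mfil d 1 (pol.mone d - pol.mm d X (charm D))"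
      unfolding mat.good_def by blast
    then have fil: "fil 1 (coeff (pol.mone d i j - pol.mm d X (charm D) i j) n)" if "i < d" "j < d" for i j n
      using that by (auto simp: pol.mfil_def)
    define x where "x n i = (\<lambda>j. if j < d then coeff (X i j) n else 0)" for n i
    \<comment> \<open>Row \<open>i\<close> of the coefficient of \<open>t ^ n\<close> in
      \<open>1 - X (t - D)\<close>, extended by zero outside the block.\<close>
    define B where "B n i = (if i < d then (if n = 0 then unit_row i else - x (n - 1) i) + rt d D (x n i) else 0)" for n i
    have rt_x: "rt d D (\<lambda>k. coeff (X i k) n) = rt d D (x n i)" for n i
      by (auto simp: rt_def x_def fun_eq_iff intro!: sum.cong)
    have B: "B n i j = coeff (pol.mone d i j - pol.mm d X (charm D) i j) n" if "i < d" "j < d" for n i j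
      using that by (simp add: B_def coeff_charm coeff_mone rt_x x_def)
    have B0: "B n i j = 0" if "d \<le> j" for n i j
      using that by (simp add: B_def unit_row_def rt_def x_def)
    have "row_fil 1 (B n i)" for n i
      unfolding row_fil_def using B0 fil B
      by (metis B_def fil_zero linorder_not_less zero_fun_apply)
    define N where "N = Max (insert 0 ((\<lambda>(i, j). Suc (degree (X i j))) ` ({..<d} \<times> {..<d})))"
    have "degree (X i j) < N" if "i < d" "j < d" for i j
      unfolding N_def using that
      by (intro less_le_trans[OF lessI Max_ge]) (auto intro!: image_eqI[of _ _ "(i, j)"])
    then have xN: "x N i = 0" if "i < d" for i
      using that by (auto simp: x_def fun_eq_iff coeff_eq_0)
    \<comment> \<open>The sum telescopes. Its remainder vanishes at \<open>M = N\<close>, as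
      \<open>N\<close> exceeds the degrees of all entries of \<open>X\<close>.\<close>
    have "(\<Sum>n\<le>M. (rt d D ^^ n) (B n i)) = unit_row i + (rt d D ^^ Suc M) (x M i)" if "i < d" for M i
    proof (induction M)
      case 0
      then show ?case using that by (simp add: B_def)
    next
      case (Suc M)
      have "(rt d D ^^ Suc M) (B (Suc M) i) = - (rt d D ^^ Suc M) (x M i) + (rt d D ^^ Suc M) (rt d D (x (Suc M) i))"
        using that by (simp add: B_def rt_pow_diff del: funpow.simps)
      then show ?case using Suc by (simp add: funpow_swap1[of "rt d D"])
    qed
    from this[of _ N] have "\<forall>i<d. unit_row i = (\<Sum>n\<le>N. (rt d D ^^ n) (B n i))"
      using xN rt_pow_zero[of "Suc N"] by simp
    then show "contracting d D"
      unfolding contracting_def using B0 \<open>\<And>n i. row_fil 1 (B n i)\<close> by blast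
  next
    assume "contracting d D"
    then obtain N B where B: "\<And>n i. row_fil 1 (B n i)" "\<And>n i j. d \<le> j \<Longrightarrow> B n i j = 0"
      "\<And>i. i < d \<Longrightarrow> unit_row i = (\<Sum>n\<le>N. (rt d D ^^ n) (B n i))"
      unfolding contracting_def by blast
    \<comment> \<open>The coefficients of the quotient: \<open>t ^ m - D ^ m\<close> is the sum of
      \<open>t ^ n * D ^ (m - n - 1)\<close> over \<open>n < m\<close>, times
      \<open>t - D\<close>.\<close>
    define x where "x n i = - (\<Sum>m\<in>{n<..N}. (rt d D ^^ (m - n - 1)) (B m i))" for n i
    have rtx: "rt d D (x n i) = - (\<Sum>m\<in>{n<..N}. (rt d D ^^ (m - n)) (B m i))" for n i
    proof -
      have "rt d D (x n i) = - (\<Sum>m\<in>{n<..N}. (rt d D ^^ 1) ((rt d D ^^ (m - n - 1)) (B m i)))"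
        using rt_pow_uminus[of 1] rt_pow_sum[of 1] by (simp add: x_def)
      also have "(\<Sum>m\<in>{n<..N}. (rt d D ^^ 1) ((rt d D ^^ (m - n - 1)) (B m i)))
          = (\<Sum>m\<in>{n<..N}. (rt d D ^^ (m - n)) (B m i))"
      proof (rule sum.cong)
        fix m assume "m \<in> {n<..N}"
        then have "m - n = Suc (m - n - 1)" by auto
        then show "(rt d D ^^ 1) ((rt d D ^^ (m - n - 1)) (B m i)) = (rt d D ^^ (m - n)) (B m i)"
          by (metis One_nat_def comp_apply funpow_0 funpow_simps_right(2) funpow.simps(2))
      qed simp
      finally show ?thesis .
    qed
    have x0: "x n i = 0" if "N \<le> n" for n i
      using that by (simp add: x_def)
    define X where "X i j = Poly (map (\<lambda>n. x n i j) [0..<N])" for i j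
    have coeff_X: "coeff (X i j) n = x n i j" for i j n
      using x0 by (auto simp: X_def coeff_Poly_eq nth_default_def)
    \<comment> \<open>The identity \<open>1 - X (t - D) = \<Sum> B n * t ^ n\<close>, compared in
      degree \<open>n\<close>. The hypothesis on the sum of the \<open>B n * D ^ n\<close> enters in
      degree 0.\<close>
    have step: "(if n = 0 then unit_row i else 0) - ((if n = 0 then 0 else x (n - 1) i) - rt d D (x n i))
        = (if n \<le> N then B n i else 0)" if "i < d" for i n
    proof (cases n)
      case 0
      have "unit_row i = B 0 i + (\<Sum>m\<in>{0<..N}. (rt d D ^^ m) (B m i))"
      proof -
        have "{..N} = insert 0 {0<..N}" by auto
        then show ?thesis using that by (simp add: B(3))
      qed
      then show ?thesis using 0 by (simp add: rtx)
    next
      case (Suc k)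
      show ?thesis
      proof (cases "n \<le> N")
        case True
        have "{k<..N} = insert n {n<..N}" using Suc True by auto
        then have "- x k i = B n i + (\<Sum>m\<in>{n<..N}. (rt d D ^^ (m - n)) (B m i))"
          unfolding x_def by (simp add: Suc)
        then show ?thesis using Suc True by (simp add: rtx)
      next
        case False
        then show ?thesis using Suc x0[of k i] x0[of n i] rt_pow_zero[of 1 d D] by simp
      qed
    qed
    have "fil 1 (coeff (pol.mone d i j - pol.mm d X (charm D) i j) n)" if "i < d" "j < d" for i j n
    proof -
      have "coeff (pol.mone d i j - pol.mm d X (charm D) i j) n
          = ((if n = 0 then unit_row i else 0) - ((if n = 0 then 0 else x (n - 1) i) - rt d D (x n i))) j"
        using that by (simp add: coeff_charm coeff_mone coeff_X)
      then show ?thesis using step[OF that(1), of n] B(1) by (simp add: row_fil_def)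
    qed
    then have "pol.mfil d 1 (pol.mone d - pol.mm d X (charm D))"
      by (simp add: pol.mfil_def)
    then show ?good unfolding mat.good_def by blast
  qed
qed

end

section \<open>Finite generation and contraction\<close>

text \<open>Serves to number the generators, which are pairs of a power of \<open>\<tau>\<close> and
  a unit row, by a single index.\<close>

lemma sum_lessThan_mult:
  fixes f :: "nat \<Rightarrow> 'a :: comm_monoid_add"
  shows "(\<Sum>j<d. \<Sum>i<c. f (i + j * c)) = sum f {..<d * c}"
proof -
  have "(\<Sum>i<c. f (i + j * c)) = sum f {j * c..<j * c + c}" for j
    using sum.shift_bounds_nat_ivl[of f 0 "j * c" c] add.commute[of c "j * c"]
    by (simp only: atLeast0LessThan add_0_left)
  then show ?thesis using sum.nat_group[of f c d] by simp
qed

text \<open>\<open>T\<close> models the skew polynomials inside the Laurent series, \<open>Ks\<close> the constants, \<open>u n\<close> the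
  powers of \<open>\<tau>\<close>, and \<open>s n\<close> those of \<open>\<sigma>\<close>.\<close>
locale trunc_ring = fring +
  fixes T Ks :: "'a \<Rightarrow> bool" and u s :: "nat \<Rightarrow> 'a"
  assumes T_add: "T a \<Longrightarrow> T b \<Longrightarrow> T (a + b)"
    and T_uminus: "T a \<Longrightarrow> T (- a)"
    and T_mul: "T a \<Longrightarrow> T b \<Longrightarrow> T (a \<odot> b)"
    and T_unit: "T unit"
    and T_u: "T (u n)"
    and T_Ks: "Ks a \<Longrightarrow> T a"
    and truncate: "\<exists>b. T b \<and> fil 1 (a - b)"
    and fil_Ks: "Ks a \<Longrightarrow> fil 0 a"
    and fil_s: "fil (int n) (s n)"
    and s_u: "s n \<odot> u n = unit"
    and T_span: "T a \<Longrightarrow> fil (- int n) a \<Longrightarrow> \<exists>c. (\<forall>i. Ks (c i)) \<and> a = (\<Sum>i\<le>n. c i \<odot> u i)"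
begin

lemma T_zero [simp]: "T 0"
  using T_add[OF T_unit T_uminus[OF T_unit]] by simp

lemma T_sum: "(\<And>i. i \<in> I \<Longrightarrow> T (f i)) \<Longrightarrow> T (\<Sum>i\<in>I. f i)"
  by (induction I rule: infinite_finite_induct) (auto intro: T_add)

definition T_row :: "nat \<Rightarrow> (nat \<Rightarrow> 'a) \<Rightarrow> bool" where
  "T_row d v \<longleftrightarrow> (\<forall>j. T (v j)) \<and> (\<forall>j\<ge>d. v j = 0)"

text \<open>The polynomials over \<open>K\<close> that act on the generators are spelled out by
  coefficients \<open>c k n\<close>, with one degree bound \<open>N\<close> for all of them.\<close>

definition fin_gen :: "nat \<Rightarrow> (nat \<Rightarrow> nat \<Rightarrow> 'a) \<Rightarrow> bool" where
  "fin_gen d D \<longleftrightarrow> (\<exists>gs. (\<forall>g\<in>set gs. T_row d g) \<and> (\<forall>m. T_row d m \<longrightarrow>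
     (\<exists>N c. (\<forall>k n. Ks (c k n)) \<and>
        m = (\<Sum>k<length gs. \<Sum>n\<le>N. lscale (c k n) ((rt d D ^^ n) (gs ! k))))))"

lemma row_fil_add: "row_fil n v \<Longrightarrow> row_fil n w \<Longrightarrow> row_fil n (v + w)"
  by (auto simp: row_fil_def intro: fil_add)

lemma row_fil_sum: "(\<And>i. i \<in> I \<Longrightarrow> row_fil n (f i)) \<Longrightarrow> row_fil n (\<Sum>i\<in>I. f i)"
  by (auto simp: row_fil_def sum_apply intro: fil_sum)

lemma row_fil_lscale: "fil m c \<Longrightarrow> row_fil n v \<Longrightarrow> row_fil (m + n) (lscale c v)"
  by (auto simp: row_fil_def lscale_def intro: fil_mul)

lemma row_fil_mono: "row_fil n v \<Longrightarrow> m \<le> n \<Longrightarrow> row_fil m v"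
  by (auto simp: row_fil_def intro: fil_mono)

lemma T_row_add: "T_row d v \<Longrightarrow> T_row d w \<Longrightarrow> T_row d (v + w)"
  by (auto simp: T_row_def intro: T_add)

lemma T_row_uminus: "T_row d v \<Longrightarrow> T_row d (- v)"
  by (auto simp: T_row_def intro: T_uminus)

lemma T_row_diff: "T_row d v \<Longrightarrow> T_row d w \<Longrightarrow> T_row d (v - w)"
  using T_row_add[of d v "- w"] by (simp add: T_row_uminus)

lemma T_row_sum: "(\<And>i. i \<in> I \<Longrightarrow> T_row d (f i)) \<Longrightarrow> T_row d (\<Sum>i\<in>I. f i)"
  by (auto simp: T_row_def sum_apply intro: T_sum)

lemma T_row_rt:
  assumes "\<And>i j. T (D i j)" "T_row d v"
  shows "T_row d ((rt d D ^^ n) v)"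
  by (induction n) (use assms in \<open>auto simp: T_row_def rt_def intro!: T_sum T_mul\<close>)

lemma row_fil_rt:
  assumes "\<And>i j. i < d \<Longrightarrow> j < d \<Longrightarrow> fil (- int e) (D i j)" "row_fil m v"
  shows "row_fil (m - int (n * e)) ((rt d D ^^ n) v)"
proof (induction n)
  case 0
  then show ?case using assms(2) by simp
next
  case (Suc n)
  then have "fil ((m - int (n * e)) + (- int e)) ((rt d D ^^ n) v k \<odot> D k j)" if "k < d" "j < d" for k j
    using assms(1) that by (intro fil_mul) (auto simp: row_fil_def)
  then show ?case
    by (auto simp: row_fil_def rt_def[of d D "(rt d D ^^ n) v"] algebra_simps intro!: fil_sum)
qed

lemma T_row_truncate:
  assumes "\<And>j. d \<le> j \<Longrightarrow> v j = 0"
  obtains w where "T_row d w" "row_fil 1 (v - w)"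
proof -
  obtain t where t: "\<And>a. T (t a) \<and> fil 1 (a - t a)" using truncate by metis
  show thesis
    by (rule that[of "\<lambda>j. if j < d then t (v j) else 0"])
      (use t assms in \<open>auto simp: T_row_def row_fil_def\<close>)
qed

text \<open>Scaling acts from the left and \<open>D\<close> from the right. An expression of
  \<open>u e\<close> times a unit row through the generators can therefore be multiplied by
  \<open>s e\<close> without disturbing the powers of \<open>D\<close>.\<close>

lemma contracting_if_fin_gen:
  assumes "fin_gen d D"
  shows "contracting d D"
proof -
  obtain gs where gs: "\<And>g. g \<in> set gs \<Longrightarrow> T_row d g"
    and span: "\<And>m. T_row d m \<Longrightarrow> \<exists>N c. (\<forall>k n. Ks (c k n)) \<and>
        m = (\<Sum>k<length gs. \<Sum>n\<le>N. lscale (c k n) ((rt d D ^^ n) (gs ! k)))"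
    using assms unfolding fin_gen_def by blast
  obtain l where l: "l \<le> 0" "\<forall>i\<in>{..<length gs} \<times> {..<d}. fil l ((gs ! fst i) (snd i))"
    using fil_ex_common[of "{..<length gs} \<times> {..<d}" 0 "\<lambda>i. (gs ! fst i) (snd i)"] by auto
  \<comment> \<open>All generators have valuation at least \<open>l\<close>, so that
    \<open>s e\<close>, a constant and a generator together have valuation at least 1.\<close>
  define e where "e = nat (1 - l)"
  have gs_fil: "row_fil l (gs ! k)" if "k < length gs" for k
    unfolding row_fil_def
  proof
    fix j
    show "fil l ((gs ! k) j)"
      using l that gs[OF nth_mem[OF that]] by (cases "j < d") (auto simp: T_row_def)
  qed
  \<comment> \<open>Each row comes with its own bound \<open>N\<close>. Demanding that
    \<open>B n\<close> vanish beyond it allows all bounds to be raised to their maximum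
    later.\<close>
  define P where "P i N B \<longleftrightarrow> (\<forall>n. row_fil 1 (B n) \<and> (\<forall>j\<ge>d. B n j = 0) \<and> (n > N \<longrightarrow> B n = 0)) \<and>
      unit_row i = (\<Sum>n\<le>N. (rt d D ^^ n) (B n))" for i N B
  have "\<exists>N B. P i N B" if "i < d" for i
  proof -
    have "T_row d (lscale (u e) (unit_row i))"
      using that by (auto simp: T_row_def lscale_def unit_row_def T_u)
    then obtain N c where c: "\<And>k n. Ks (c k n)"
      and eq: "lscale (u e) (unit_row i) = (\<Sum>k<length gs. \<Sum>n\<le>N. lscale (c k n) ((rt d D ^^ n) (gs ! k)))"
      using span by blast
    define B where "B n = (if n \<le> N then \<Sum>k<length gs. lscale (s e \<odot> c k n) (gs ! k) else 0)" for n
    have "unit_row i = lscale (s e) (lscale (u e) (unit_row i))"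
      by (simp add: lscale_lscale s_u) (simp add: lscale_def)
    also have "\<dots> = (\<Sum>k<length gs. \<Sum>n\<le>N. lscale (s e \<odot> c k n) ((rt d D ^^ n) (gs ! k)))"
      by (simp only: eq lscale_sum lscale_lscale)
    also have "\<dots> = (\<Sum>n\<le>N. (rt d D ^^ n) (B n))"
      by (subst sum.swap) (simp add: B_def rt_pow_sum rt_pow_lscale)
    finally have "unit_row i = (\<Sum>n\<le>N. (rt d D ^^ n) (B n))" .
    moreover have "row_fil 1 (B n)" for n
    proof -
      have "row_fil (int e + 0 + l) (lscale (s e \<odot> c k n) (gs ! k))" if "k < length gs" for k
        using that by (intro row_fil_lscale fil_mul fil_s fil_Ks c gs_fil)
      moreover have "int e + 0 + l = 1" using l by (simp add: e_def)
      ultimately show ?thesis unfolding B_def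
        by (auto intro!: row_fil_sum) (simp add: row_fil_def)
    qed
    moreover have "B n j = 0" if "d \<le> j" for n j
      using that gs[OF nth_mem] by (auto simp: B_def sum_apply lscale_def T_row_def)
    moreover have "n > N \<longrightarrow> B n = 0" for n by (simp add: B_def)
    ultimately show ?thesis unfolding P_def by blast
  qed
  then have "\<forall>i\<in>{..<d}. \<exists>NB. P i (fst NB) (snd NB)" by simp
  then obtain NB where "\<And>i. i < d \<Longrightarrow> P i (fst (NB i)) (snd (NB i))"
    by (metis bchoice lessThan_iff)
  then obtain N B where "\<And>i. i < d \<Longrightarrow> P i (N i) (B i)"
    by (rule that)
  then have B: "\<And>i n. i < d \<Longrightarrow> row_fil 1 (B i n)" "\<And>i n j. i < d \<Longrightarrow> d \<le> j \<Longrightarrow> B i n j = 0"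
    "\<And>i n. i < d \<Longrightarrow> n > N i \<Longrightarrow> B i n = 0"
    "\<And>i. i < d \<Longrightarrow> unit_row i = (\<Sum>n\<le>N i. (rt d D ^^ n) (B i n))"
    unfolding P_def by blast+
  define M where "M = Max (insert 0 (N ` {..<d}))"
  have M: "N i \<le> M" if "i < d" for i
    unfolding M_def using that by (intro Max_ge) auto
  have "unit_row i = (\<Sum>n\<le>M. (rt d D ^^ n) (B i n))" if "i < d" for i
  proof -
    have "(\<Sum>n\<le>N i. (rt d D ^^ n) (B i n)) = (\<Sum>n\<le>M. (rt d D ^^ n) (B i n))"
      using M[OF that] B(3)[OF that] by (intro sum.mono_neutral_left) auto
    then show ?thesis using B(4)[OF that] by simp
  qed
  then show ?thesis unfolding contracting_def
    using B(1,2)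
    by (intro exI[of _ M] exI[of _ "\<lambda>n i. if i < d then B i n else 0"])
      (auto simp: row_fil_def)
qed

text \<open>Induction on the degree of a row \<open>m\<close>: the rows \<open>m * B n\<close> have
  smaller degree, their polynomial parts are covered by the induction hypothesis, and what is cut
  off contributes a polynomial remainder whose degree is bounded independently of
  \<open>m\<close>.\<close>

lemma fin_gen_if_contracting:
  assumes "contracting d D" and TD: "\<And>i j. T (D i j)"
  shows "fin_gen d D"
proof -
  obtain N B where B: "\<And>n i. row_fil 1 (B n i)" "\<And>n i j. d \<le> j \<Longrightarrow> B n i j = 0"
    "\<And>i. i < d \<Longrightarrow> unit_row i = (\<Sum>n\<le>N. (rt d D ^^ n) (B n i))"
    using assms(1) unfolding contracting_def by blast
  obtain l where l: "l \<le> 0" "\<forall>i\<in>{..<d} \<times> {..<d}. fil l (D (fst i) (snd i))"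
    using fil_ex_common[of "{..<d} \<times> {..<d}" 0 "\<lambda>i. D (fst i) (snd i)"] by auto
  define e where "e = nat (- l)"
  have fil_D: "fil (- int e) (D i j)" if "i < d" "j < d" for i j
    using l that by (auto simp: e_def)
  \<comment> \<open>Each factor \<open>D\<close> lowers the valuation by at most \<open>e\<close>,
    hence \<open>D ^ n\<close> with \<open>n \<le> N\<close> by at most \<open>c\<close>.\<close>
  define c where "c = N * e"
  \<comment> \<open>The \<open>K[t]\<close>-span of the polynomial rows of degree at most
    \<open>c\<close>.\<close>
  define S where "S = {m. \<exists>M w. (\<forall>n. T_row d (w n) \<and> row_fil (- int c) (w n)) \<and>
      m = (\<Sum>n\<le>M. (rt d D ^^ n) (w n))}"
  have T_row_0: "T_row d 0" and row_fil_0: "row_fil n 0" for n by (simp_all add: T_row_def row_fil_def)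
  have S_base: "v \<in> S" if "T_row d v" "row_fil (- int c) v" for v
    using that unfolding S_def by (intro CollectI exI[of _ 0] exI[of _ "\<lambda>_. v"]) simp
  have S_add: "v + v' \<in> S" if v: "v \<in> S" "v' \<in> S" for v v'
  proof -
    obtain M w where w: "\<And>n. T_row d (w n) \<and> row_fil (- int c) (w n)" "v = (\<Sum>n\<le>M. (rt d D ^^ n) (w n))"
      using v unfolding S_def by blast
    obtain M' w' where w': "\<And>n. T_row d (w' n) \<and> row_fil (- int c) (w' n)" "v' = (\<Sum>n\<le>M'. (rt d D ^^ n) (w' n))"
      using v unfolding S_def by blast
    define z where "z M w n = (if n \<le> M then w n else 0)" for M and w :: "nat \<Rightarrow> nat \<Rightarrow> 'a" and n :: nat
    have z: "(\<Sum>n\<le>M. (rt d D ^^ n) (w n)) = (\<Sum>n\<le>max M1 M2. (rt d D ^^ n) (z M w n))"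
      if "M \<le> max M1 M2" for M M1 M2 w
      using that by (intro sum.mono_neutral_cong_left) (auto simp: z_def)
    have "v + v' = (\<Sum>n\<le>max M M'. (rt d D ^^ n) (z M w n + z M' w' n))"
      unfolding w(2) w'(2) by (simp add: z[of M M M'] z[of M' M M'] rt_pow_add sum.distrib)
    moreover have "T_row d (z M w n + z M' w' n) \<and> row_fil (- int c) (z M w n + z M' w' n)" for n
      using w w' T_row_0 row_fil_0 by (auto simp: z_def intro!: T_row_add row_fil_add)
    ultimately show ?thesis unfolding S_def
      by (intro CollectI exI[of _ "max M M'"] exI[of _ "\<lambda>n. z M w n + z M' w' n"]) simp
  qed
  have S_rt: "(rt d D ^^ k) v \<in> S" if v: "v \<in> S" for k v
  proof -
    obtain M w where w: "\<And>n. T_row d (w n) \<and> row_fil (- int c) (w n)" "v = (\<Sum>n\<le>M. (rt d D ^^ n) (w n))"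
      using v unfolding S_def by blast
    define w' where "w' n = (if k \<le> n then w (n - k) else 0)" for n
    have "(rt d D ^^ k) v = (\<Sum>n\<le>M. (rt d D ^^ (n + k)) (w' (n + k)))"
      by (simp add: w(2) rt_pow_sum w'_def add.commute[of _ k] funpow_add)
    also have "\<dots> = (\<Sum>n\<in>{k..M + k}. (rt d D ^^ n) (w' n))"
      using sum.shift_bounds_cl_nat_ivl[of "\<lambda>n. (rt d D ^^ n) (w' n)" 0 k M]
      by (simp add: atMost_atLeast0)
    also have "\<dots> = (\<Sum>n\<le>M + k. (rt d D ^^ n) (w' n))"
      by (rule sum.mono_neutral_left) (auto simp: w'_def)
    finally show ?thesis
      using w T_row_0 row_fil_0 unfolding S_def
      by (intro CollectI exI[of _ "M + k"] exI[of _ w']) (auto simp: w'_def)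
  qed
  have S_sum: "(\<Sum>i\<in>I. f i) \<in> S" if "finite I" "\<And>i. i \<in> I \<Longrightarrow> f i \<in> S" for I :: "nat set" and f
    using that S_base[OF T_row_0 row_fil_0] S_add
    by (induction I) auto
  have "m \<in> S" if "T_row d m" "row_fil (- int k) m" for m k
    using that
  proof (induction k arbitrary: m)
    case 0
    then show ?case by (intro S_base) (auto elim: row_fil_mono)
  next
    case (Suc k)
    \<comment> \<open>The row \<open>m * B n\<close>. It has valuation at least \<open>- k\<close>,
      but in general it is no longer polynomial.\<close>
    define p where "p n = (\<Sum>i<d. lscale (m i) (B n i))" for n
    have m: "m = (\<Sum>n\<le>N. (rt d D ^^ n) (p n))"
    proof -
      have "m = (\<Sum>i<d. lscale (m i) (\<Sum>n\<le>N. (rt d D ^^ n) (B n i)))"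
        using row_expand[of d m] Suc.prems(1) B(3) by (simp add: T_row_def)
      also have "\<dots> = (\<Sum>n\<le>N. \<Sum>i<d. lscale (m i) ((rt d D ^^ n) (B n i)))"
        by (subst sum.swap) (simp only: lscale_sum)
      finally show ?thesis by (simp add: p_def rt_pow_sum rt_pow_lscale)
    qed
    have "\<exists>y. T_row d y \<and> row_fil 1 (p n - y)" for n
    proof -
      have "p n j = 0" if "d \<le> j" for j
        using B(2) that by (simp add: p_def sum_apply lscale_def)
      then show ?thesis by (rule T_row_truncate) blast+
    qed
    then obtain y where y: "\<And>n. T_row d (y n)" "\<And>n. row_fil 1 (p n - y n)" by metis
    have "row_fil (- int k) (y n)" for n
    proof -
      have "row_fil (- int (Suc k) + 1) (p n)"
        using Suc.prems(2) B(1) unfolding p_def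
        by (intro row_fil_sum row_fil_lscale) (auto simp: row_fil_def)
      then have "fil (- int k) (p n j - (p n - y n) j)" for j
        using y(2)[of n] by (intro fil_diff) (auto simp: row_fil_def intro: fil_mono[of 1])
      then show ?thesis by (simp add: row_fil_def)
    qed
    then have y_S: "y n \<in> S" for n
      using Suc.IH y(1) by blast
    \<comment> \<open>As a difference of polynomial rows the remainder is polynomial; as the sum of
      the \<open>(p n - y n) * D ^ n\<close> it has valuation at least \<open>- c\<close>. Both are
      needed to place it in \<open>S\<close>.\<close>
    define r where "r = m - (\<Sum>n\<le>N. (rt d D ^^ n) (y n))"
    have "T_row d r"
      unfolding r_def using Suc.prems y(1) TD by (intro T_row_diff T_row_sum T_row_rt) auto
    moreover have "row_fil (- int c) r"
    proof -
      have "r = (\<Sum>n\<le>N. (rt d D ^^ n) (p n - y n))"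
        unfolding r_def by (subst m) (simp add: rt_pow_diff sum_subtractf)
      moreover have "row_fil (- int c) ((rt d D ^^ n) (p n - y n))" if "n \<le> N" for n
      proof (rule row_fil_mono)
        show "row_fil (1 - int (n * e)) ((rt d D ^^ n) (p n - y n))"
          using fil_D y(2) by (intro row_fil_rt)
        show "- int c \<le> 1 - int (n * e)"
          using mult_le_mono1[OF that, of e] unfolding c_def by linarith
      qed
      ultimately show ?thesis by (auto intro: row_fil_sum)
    qed
    ultimately have "r \<in> S" by (rule S_base)
    then have "(\<Sum>n\<le>N. (rt d D ^^ n) (y n)) + r \<in> S"
      by (intro S_add S_sum S_rt y_S) auto
    then show ?case by (simp add: r_def)
  qed
  then have all_S: "m \<in> S" if "T_row d m" for m
  proof -
    obtain n where n: "n \<le> 0" "\<forall>j\<in>{..<d}. fil n (m j)"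
      using fil_ex_common[of "{..<d}" 0 m] by auto
    have "fil n (m j)" for j
      using n that by (cases "j < d") (auto simp: T_row_def)
    then have "row_fil (- int (nat (- n))) m"
      using n by (simp add: row_fil_def)
    then show ?thesis
      using that \<open>\<And>m k. T_row d m \<Longrightarrow> row_fil (- int k) m \<Longrightarrow> m \<in> S\<close> by blast
  qed
  \<comment> \<open>The generators \<open>\<tau> ^ i\<close> times a unit row \<open>j\<close>, for
    \<open>i \<le> c\<close> and \<open>j < d\<close>, numbered by
    \<open>k = i + j * Suc c\<close>.\<close>
  define g where "g k = lscale (u (k mod Suc c)) (unit_row (k div Suc c))" for k
  define gs where "gs = map g [0..<d * Suc c]"
  have "T_row d h" if "h \<in> set gs" for h
  proof -
    obtain k where "k < d * Suc c" "h = g k" using \<open>h \<in> set gs\<close> by (auto simp: gs_def simp del: mult_Suc_right)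
    moreover from this have "k div Suc c < d" by (simp add: less_mult_imp_div_less)
    ultimately show ?thesis
      by (auto simp: g_def T_row_def lscale_def unit_row_def T_u)
  qed
  moreover have "\<exists>M a. (\<forall>k n. Ks (a k n)) \<and>
      m = (\<Sum>k<length gs. \<Sum>n\<le>M. lscale (a k n) ((rt d D ^^ n) (gs ! k)))" if "T_row d m" for m
  proof -
    obtain M w where w: "\<And>n. T_row d (w n)" "\<And>n. row_fil (- int c) (w n)" "m = (\<Sum>n\<le>M. (rt d D ^^ n) (w n))"
      using all_S[OF \<open>T_row d m\<close>] unfolding S_def by blast
    have "\<exists>a. (\<forall>i. Ks (a i)) \<and> w n j = (\<Sum>i\<le>c. a i \<odot> u i)" for n j
      using w(1,2) by (intro T_span) (auto simp: T_row_def row_fil_def)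
    then obtain a where a: "\<And>n j i. Ks (a n j i)" "\<And>n j. w n j = (\<Sum>i\<le>c. a n j i \<odot> u i)" by metis
    have wn: "w n = (\<Sum>k<d * Suc c. lscale (a n (k div Suc c) (k mod Suc c)) (g k))" for n
    proof -
      define h where "h k = lscale (a n (k div Suc c) (k mod Suc c)) (g k)" for k
      have "w n = (\<Sum>j<d. lscale (w n j) (unit_row j))"
        using w(1) by (intro row_expand) (auto simp: T_row_def)
      also have "\<dots> = (\<Sum>j<d. \<Sum>i<Suc c. lscale (a n j i) (lscale (u i) (unit_row j)))"
        by (simp only: a(2) lscale_sum_left lscale_lscale lessThan_Suc_atMost)
      also have "\<dots> = (\<Sum>j<d. \<Sum>i<Suc c. h (i + j * Suc c))"
        by (intro sum.cong refl) (simp_all add: g_def h_def del: mult_Suc_right)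
      also have "\<dots> = (\<Sum>k<d * Suc c. h k)"
        by (rule sum_lessThan_mult)
      finally show ?thesis by (simp only: h_def)
    qed
    have "m = (\<Sum>k<d * Suc c. \<Sum>n\<le>M. lscale (a n (k div Suc c) (k mod Suc c)) ((rt d D ^^ n) (g k)))"
      unfolding w(3) by (subst sum.swap) (simp add: wn rt_pow_sum rt_pow_lscale)
    then show ?thesis
      using a(1) by (intro exI[of _ M] exI[of _ "\<lambda>k n. a n (k div Suc c) (k mod Suc c)"])
        (simp add: gs_def del: mult_Suc_right)
  qed
  ultimately show ?thesis unfolding fin_gen_def by blast
qed

end

section \<open>Skew Laurent series\<close>

text \<open>Validity of a Laurent series does not depend on \<open>q\<close>, so that the additive group is a type;
  only the multiplication carries \<open>q\<close> as a parameter.\<close>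
typedef (overloaded) 'k laurent = "{f :: 'k::field ls. ls_valid f}"
  morphisms lcoeff Laurent
  by (rule exI[of _ "\<lambda>_. 0"]) (simp add: ls_valid_def)

instantiation laurent :: (field) ab_group_add
begin

definition "0 = Laurent (\<lambda>_. 0)"
definition "a + b = Laurent (\<lambda>i. lcoeff a i + lcoeff b i)"
definition "- a = Laurent (\<lambda>i. - lcoeff a i)"
definition "a - b = Laurent (\<lambda>i. lcoeff a i - lcoeff b i)"

lemma lcoeff_bound: "\<exists>N. \<forall>i<N. lcoeff a i = 0"
  using lcoeff[of a] by (simp add: ls_valid_def)

lemma lcoeff_Laurent:
  assumes "\<And>i. i < N \<Longrightarrow> f i = 0"
  shows "lcoeff (Laurent f) = f"
  using assms by (intro Laurent_inverse) (auto simp: ls_valid_def)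

lemma lcoeff_zero: "lcoeff 0 i = 0"
  unfolding zero_laurent_def by (subst lcoeff_Laurent) auto

lemma lcoeff_add: "lcoeff (a + b) i = lcoeff a i + lcoeff b i"
proof -
  obtain M N where "\<forall>i<M. lcoeff a i = 0" "\<forall>i<N. lcoeff b i = 0" using lcoeff_bound by metis
  then show ?thesis unfolding plus_laurent_def
    by (subst lcoeff_Laurent[of "min M N"]) auto
qed

lemma lcoeff_uminus: "lcoeff (- a) i = - lcoeff a i"
proof -
  obtain M where "\<forall>i<M. lcoeff a i = 0" using lcoeff_bound by metis
  then show ?thesis unfolding uminus_laurent_def
    by (subst lcoeff_Laurent[of M]) auto
qed

lemma lcoeff_diff: "lcoeff (a - b) i = lcoeff a i - lcoeff b i"
proof -
  obtain M N where "\<forall>i<M. lcoeff a i = 0" "\<forall>i<N. lcoeff b i = 0" using lcoeff_bound by metis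
  then show ?thesis unfolding minus_laurent_def
    by (subst lcoeff_Laurent[of "min M N"]) auto
qed

lemma laurent_eqI: "(\<And>i. lcoeff a i = lcoeff b i) \<Longrightarrow> a = b"
  using lcoeff_inject by blast

instance
  by standard (auto intro!: laurent_eqI simp: lcoeff_add lcoeff_zero lcoeff_uminus lcoeff_diff)

end

declare lcoeff_zero [simp] lcoeff_add [simp] lcoeff_uminus [simp] lcoeff_diff [simp]

lemma lcoeff_sum: "lcoeff (\<Sum>i\<in>I. f i) k = (\<Sum>i\<in>I. lcoeff (f i) k)"
  by (induction I rule: infinite_finite_induct) auto

definition lsingle :: "int \<Rightarrow> 'k \<Rightarrow> 'k::field laurent" where
  "lsingle n x = Laurent (\<lambda>i. if i = n then x else 0)"

lemma lcoeff_lsingle: "lcoeff (lsingle n x) i = (if i = n then x else 0)"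
  unfolding lsingle_def by (subst lcoeff_Laurent[of n]) auto

definition lfil :: "int \<Rightarrow> 'k::field laurent \<Rightarrow> bool" where
  "lfil n a \<longleftrightarrow> (\<forall>i<n. lcoeff a i = 0)"

lemma lfil_add: "lfil n a \<Longrightarrow> lfil n b \<Longrightarrow> lfil n (a + b)"
  by (simp add: lfil_def)

lemma lfil_zero: "lfil n 0"
  by (simp add: lfil_def)

lemma lfil_uminus: "lfil n a \<Longrightarrow> lfil n (- a)"
  by (simp add: lfil_def)

lemma lfil_mono: "lfil n a \<Longrightarrow> m \<le> n \<Longrightarrow> lfil m a"
  by (simp add: lfil_def)

lemma lfil_bot: "\<exists>n. lfil n a"
  using lcoeff_bound[of a] by (simp add: lfil_def)

lemma lfil_lead:
  assumes "a \<noteq> 0"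
  obtains m where "lfil m a" "lcoeff a m \<noteq> 0"
proof -
  obtain k where k: "lcoeff a k \<noteq> 0" using assms laurent_eqI[of a 0] by auto
  obtain n where n: "lfil n a" using lfil_bot by blast
  have "n \<le> k" using n k by (force simp: lfil_def)
  define S where "S = {i\<in>{n..k}. lcoeff a i \<noteq> 0}"
  have S: "finite S" "k \<in> S"
    using k \<open>n \<le> k\<close> by (auto simp: S_def intro: finite_subset[of _ "{n..k}"])
  have "lcoeff a (Min S) \<noteq> 0" using Min_in[of S] S by (auto simp: S_def)
  moreover have "lcoeff a i = 0" if "i < Min S" for i
  proof (rule ccontr)
    assume "lcoeff a i \<noteq> 0"
    moreover have "i \<le> k" using that Min_le[OF S] by linarith
    moreover have "n \<le> i" using n \<open>lcoeff a i \<noteq> 0\<close> by (force simp: lfil_def)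
    ultimately have "i \<in> S" by (simp add: S_def)
    then show False using that Min_le[OF S(1)] by fastforce
  qed
  ultimately show thesis by (intro that[of "Min S"]) (auto simp: lfil_def)
qed

text \<open>The image of \<open>K{\<tau>}\<close>: every series is bounded below, so only finitely
  many powers of \<open>\<tau>\<close> can remain.\<close>

definition lpol :: "'k::field laurent \<Rightarrow> bool" where
  "lpol a \<longleftrightarrow> (\<forall>k>0. lcoeff a k = 0)"

definition lconst :: "'k::field laurent \<Rightarrow> bool" where
  "lconst a \<longleftrightarrow> (\<forall>k. k \<noteq> 0 \<longrightarrow> lcoeff a k = 0)"

definition lmul :: "nat \<Rightarrow> 'k::field laurent \<Rightarrow> 'k laurent \<Rightarrow> 'k laurent" where
  "lmul q a b = Laurent (ls_mult q (lcoeff a) (lcoeff b))"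

text \<open>For \<open>c\<close> of valuation \<open>m\<close>, the coefficient of
  \<open>\<sigma> ^ (n - m)\<close> in the left inverse of \<open>c\<close>: the equation for the
  \<open>n\<close>-th coefficient of the product, solved for its last summand.\<close>

fun linv_coeff :: "nat \<Rightarrow> int \<Rightarrow> 'k::field laurent \<Rightarrow> nat \<Rightarrow> 'k" where
  "linv_coeff q m c n = ((if n = 0 then 1 else 0) -
     (\<Sum>i<n. linv_coeff q m c i * frz q (m - int i) (lcoeff c (m + int n - int i)))) /
     frz q (m - int n) (lcoeff c m)"

text \<open>The \<open>q\<close>-th power map as an automorphism of \<open>K\<close>. In this form
  the finite subfield and the perfectness of \<open>K\<close> enter.\<close>

locale frobenius_field =
  fixes q :: nat and K :: "'k::field itself"
  assumes frobq_add: "frobq q (x + y :: 'k) = frobq q x + frobq q y"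
    and frobq_bij: "bij (frobq q :: 'k \<Rightarrow> 'k)"
begin

abbreviation rootq :: "'k \<Rightarrow> 'k" where
  "rootq \<equiv> inv_into UNIV (frobq q)"

lemma frz_0 [simp]: "frz q 0 x = x"
  by (simp add: frz_def)

lemma frz_nat: "frz q (int n) (x :: 'k) = x ^ (q ^ n)"
proof -
  have "(frobq q ^^ n) x = x ^ (q ^ n)"
    by (induction n) (simp_all add: frobq_def mult.commute flip: power_mult)
  then show ?thesis by (simp add: frz_def)
qed

lemma frobq_rootq: "frobq q (rootq x) = (x :: 'k)"
  using frobq_bij by (simp add: bij_is_surj surj_f_inv_f)

lemma rootq_frobq: "rootq (frobq q x) = (x :: 'k)"
  using frobq_bij by (simp add: bij_is_inj)

lemma frz_Suc: "frz q (n + 1) (x :: 'k) = frobq q (frz q n x)"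
proof (cases "n \<ge> 0")
  case True
  then have "nat (n + 1) = Suc (nat n)" by auto
  with True show ?thesis by (simp add: frz_def)
next
  case False
  then have "nat (- n) = Suc (nat (- (n + 1)))" by auto
  \<comment> \<open>For \<open>n = - 1\<close> the left-hand side falls under the nonnegative case
    of \<open>frz\<close>, where the exponent is 0.\<close>
  moreover have "frz q (n + 1) x = (rootq ^^ nat (- (n + 1))) x"
    using False by (cases "n = - 1") (auto simp: frz_def)
  ultimately show ?thesis using False by (simp add: frz_def frobq_rootq)
qed

lemma frz_pred: "frz q (n - 1) (x :: 'k) = rootq (frz q n x)"
  using frz_Suc[of "n - 1" x] by (simp add: rootq_frobq)

lemma frz_frz: "frz q m (frz q n (x :: 'k)) = frz q (m + n) x"
proof (induction m rule: int_induct[where k = 0])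
  case (step1 m)
  have "frz q (m + 1 + n) x = frz q (m + n + 1) x" by (simp add: algebra_simps)
  with step1 show ?case by (simp only: frz_Suc)
next
  case (step2 m)
  have "frz q (m - 1 + n) x = frz q (m + n - 1) x" by (simp add: algebra_simps)
  with step2 show ?case by (simp only: frz_pred)
qed simp

lemma rootq_add: "rootq (x + y :: 'k) = rootq x + rootq y"
  using rootq_frobq[of "rootq x + rootq y"] by (simp add: frobq_add frobq_rootq)

lemma frobq_mult: "frobq q (x * y :: 'k) = frobq q x * frobq q y"
  by (simp add: frobq_def power_mult_distrib)

lemma rootq_mult: "rootq (x * y :: 'k) = rootq x * rootq y"
  using rootq_frobq[of "rootq x * rootq y"] by (simp add: frobq_mult frobq_rootq)

lemma frz_add: "frz q n (x + y :: 'k) = frz q n x + frz q n y"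
  by (induction n rule: int_induct[where k = 0])
    (simp_all add: frz_Suc frz_pred frobq_add rootq_add)

lemma frz_mult: "frz q n (x * y :: 'k) = frz q n x * frz q n y"
  by (induction n rule: int_induct[where k = 0])
    (simp_all add: frz_Suc frz_pred frobq_mult rootq_mult)

lemma frz_zero [simp]: "frz q n (0 :: 'k) = 0"
  using frz_add[of n 0 0] by (metis add.right_neutral add_left_cancel)

lemma frz_eq_0_iff [simp]: "frz q n (x :: 'k) = 0 \<longleftrightarrow> x = 0"
proof
  assume "frz q n x = 0"
  then have "frz q (- n) (frz q n x) = 0" by simp
  then show "x = 0" by (simp add: frz_frz)
qed simp

lemma frz_one [simp]: "frz q n (1 :: 'k) = 1"
proof -
  have "frz q n (1 :: 'k) * frz q n 1 = frz q n 1" by (simp flip: frz_mult)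
  then show ?thesis by simp
qed

lemma frz_sum: "frz q n (\<Sum>i\<in>I. f i :: 'k) = (\<Sum>i\<in>I. frz q n (f i))"
  by (induction I rule: infinite_finite_induct) (auto simp: frz_add)

text \<open>The index set in \<open>ls_mult\<close> depends on the supports of both factors. Any
  lower bounds turn it into an interval, so that products with different factors can be compared
  term by term.\<close>

lemma ls_mult_eq:
  fixes a b :: "'k ls"
  assumes "\<And>i. i < A \<Longrightarrow> a i = 0" "\<And>i. i < B \<Longrightarrow> b i = 0"
  shows "ls_mult q a b k = (\<Sum>i\<in>{A..k - B}. a i * frz q (- i) (b (k - i)))"
proof -
  have "i \<in> {A..k - B}" if "a i \<noteq> 0" "b (k - i) \<noteq> 0" for i
    using that assms(1)[of i] assms(2)[of "k - i"] by force
  then show ?thesis unfolding ls_mult_def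
    by (intro sum.mono_neutral_left) auto
qed

lemma lcoeff_lmul':
  fixes a b :: "'k laurent"
  shows "lcoeff (lmul q a b) = ls_mult q (lcoeff a) (lcoeff b)"
proof -
  obtain m n where "lfil m a" "lfil n b" using lfil_bot by metis
  then have "ls_mult q (lcoeff a) (lcoeff b) k = 0" if "k < m + n" for k
    using that by (subst ls_mult_eq[of m _ n]) (auto simp: lfil_def)
  then show ?thesis unfolding lmul_def by (rule lcoeff_Laurent)
qed

lemma lcoeff_lmul:
  fixes a b :: "'k laurent"
  assumes "lfil A a" "lfil B b"
  shows "lcoeff (lmul q a b) k = (\<Sum>i\<in>{A..k - B}. lcoeff a i * frz q (- i) (lcoeff b (k - i)))"
  unfolding lcoeff_lmul' using assms by (intro ls_mult_eq) (auto simp: lfil_def)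

lemma lfil_lmul:
  fixes a b :: "'k laurent"
  shows "lfil m a \<Longrightarrow> lfil n b \<Longrightarrow> lfil (m + n) (lmul q a b)"
  by (subst lfil_def) (simp add: lcoeff_lmul)

lemma lcoeff_lmul_lead:
  fixes a b :: "'k laurent"
  assumes "lfil m a" "lfil n b"
  shows "lcoeff (lmul q a b) (m + n) = lcoeff a m * frz q (- m) (lcoeff b n)"
  by (simp add: lcoeff_lmul[OF assms])

lemma lcoeff_lsingle_lmul:
  fixes a :: "'k laurent"
  shows "lcoeff (lmul q (lsingle n x) a) k = x * frz q (- n) (lcoeff a (k - n))"
proof -
  obtain m where m: "lfil m a" using lfil_bot by blast
  have "lfil n (lsingle n x)" by (simp add: lfil_def lcoeff_lsingle)
  then have "lcoeff (lmul q (lsingle n x) a) k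
      = (\<Sum>i\<in>{n..k - m}. lcoeff (lsingle n x) i * frz q (- i) (lcoeff a (k - i)))"
    using m by (rule lcoeff_lmul)
  also have "\<dots> = (\<Sum>i\<in>{n..k - m}. if i = n then x * frz q (- n) (lcoeff a (k - n)) else 0)"
    by (intro sum.cong) (auto simp: lcoeff_lsingle)
  also have "\<dots> = x * frz q (- n) (lcoeff a (k - n))"
    using m by (auto simp: lfil_def)
  finally show ?thesis .
qed

lemma lcoeff_lmul_lsingle:
  fixes a :: "'k laurent"
  shows "lcoeff (lmul q a (lsingle n x)) k = lcoeff a (k - n) * frz q (n - k) x"
proof -
  obtain m where m: "lfil m a" using lfil_bot by blast
  have "lfil n (lsingle n x)" by (simp add: lfil_def lcoeff_lsingle)
  from m this have "lcoeff (lmul q a (lsingle n x)) k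
      = (\<Sum>i\<in>{m..k - n}. lcoeff a i * frz q (- i) (lcoeff (lsingle n x) (k - i)))"
    by (rule lcoeff_lmul)
  also have "\<dots> = (\<Sum>i\<in>{m..k - n}. if i = k - n then lcoeff a (k - n) * frz q (n - k) x else 0)"
    by (intro sum.cong) (auto simp: lcoeff_lsingle)
  also have "\<dots> = lcoeff a (k - n) * frz q (n - k) x"
    using m by (auto simp: lfil_def)
  finally show ?thesis .
qed

text \<open>Both bracketings are sums of the same twisted terms \<open>t i j\<close> over
  \<open>A \<le> i\<close>, \<open>B \<le> j\<close>, \<open>i + j \<le> k - C\<close>. The twists
  agree because \<open>frz\<close> turns addition of exponents into composition.\<close>

lemma lmul_assoc:
  fixes a b c :: "'k laurent"
  shows "lmul q (lmul q a b) c = lmul q a (lmul q b c)"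
proof (rule laurent_eqI)
  fix k
  obtain A B C where *: "lfil A a" "lfil B b" "lfil C c" using lfil_bot by metis
  define t where "t i j = lcoeff a i * (frz q (- i) (lcoeff b j) * frz q (- (i + j)) (lcoeff c (k - i - j)))" for i j
  have "lcoeff (lmul q (lmul q a b) c) k = (\<Sum>n\<in>{A + B..k - C}. \<Sum>i\<in>{A..n - B}. t i (n - i))"
    by (simp add: lcoeff_lmul[OF lfil_lmul[OF *(1,2)] *(3)] lcoeff_lmul[OF *(1,2)] sum_distrib_right t_def mult.assoc)
  also have "\<dots> = (\<Sum>i\<in>{A..k - (B + C)}. \<Sum>j\<in>{B..k - i - C}. t i j)"
    unfolding sum.Sigma[OF finite_atLeastAtMost_int ballI[OF finite_atLeastAtMost_int]]
    by (rule sum.reindex_bij_witness[of _ "\<lambda>(i, j). (i + j, i)" "\<lambda>(n, i). (i, n - i)"]) auto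
  also have "\<dots> = lcoeff (lmul q a (lmul q b c)) k"
    by (simp add: lcoeff_lmul[OF *(1) lfil_lmul[OF *(2,3)]] lcoeff_lmul[OF *(2,3)] sum_distrib_left
        t_def frz_sum frz_mult frz_frz algebra_simps)
  finally show "lcoeff (lmul q (lmul q a b) c) k = lcoeff (lmul q a (lmul q b c)) k" .
qed

lemma lmul_fring: "fring (lmul q) (lsingle 0 1 :: 'k laurent) lfil"
proof (unfold_locales, goal_cases)
  case (2 a b c)
  obtain A B C where "lfil A a" "lfil B b" "lfil C c" using lfil_bot by metis
  \<comment> \<open>A common lower bound of the two summands makes all three products sums over the
    same interval.\<close>
  then have *: "lfil (min A B) a" "lfil (min A B) b" "lfil C c" by (auto intro: lfil_mono)
  show ?case
    by (rule laurent_eqI)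
      (simp add: lcoeff_lmul[OF lfil_add[OF *(1,2)] *(3)] lcoeff_lmul[OF *(1,3)] lcoeff_lmul[OF *(2,3)]
        distrib_right sum.distrib)
next
  case (3 a b c)
  obtain A B C where "lfil A a" "lfil B b" "lfil C c" using lfil_bot by metis
  then have *: "lfil A a" "lfil (min B C) b" "lfil (min B C) c" by (auto intro: lfil_mono)
  show ?case
    by (rule laurent_eqI)
      (simp add: lcoeff_lmul[OF *(1) lfil_add[OF *(2,3)]] lcoeff_lmul[OF *(1,2)] lcoeff_lmul[OF *(1,3)]
        distrib_left frz_add sum.distrib)
qed (auto intro: lmul_assoc lfil_lmul laurent_eqI lfil_bot lfil_mono lfil_add
      simp: lcoeff_lsingle_lmul lcoeff_lmul_lsingle lfil_zero lfil_uminus)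

lemma lmul_left_inverse:
  fixes c :: "'k laurent"
  assumes "lfil m c" "lcoeff c m \<noteq> 0"
  obtains b where "lmul q b c = lsingle 0 1" "lfil (- m) b"
proof -
  define b where "b = Laurent (\<lambda>k. if k < - m then 0 else linv_coeff q m c (nat (k + m)))"
  have lcoeff_b: "lcoeff b k = (if k < - m then 0 else linv_coeff q m c (nat (k + m)))" for k
    unfolding b_def by (subst lcoeff_Laurent[of "- m"]) auto
  have fil: "lfil (- m) b" by (simp add: lfil_def lcoeff_b)
  have "lcoeff (lmul q b c) k = (if k = 0 then 1 else 0)" for k
  proof (cases "k < 0")
    case True
    then show ?thesis by (simp add: lcoeff_lmul[OF fil assms(1)])
  next
    case False
    define n where "n = nat k"
    have k: "k = int n" using False by (simp add: n_def)
    have "lcoeff (lmul q b c) k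
        = (\<Sum>i\<le>n. linv_coeff q m c i * frz q (m - int i) (lcoeff c (m + int n - int i)))"
      unfolding lcoeff_lmul[OF fil assms(1)]
      by (rule sum.reindex_bij_witness[of _ "\<lambda>i. int i - m" "\<lambda>i. nat (i + m)"])
        (auto simp: lcoeff_b k algebra_simps simp del: linv_coeff.simps)
    \<comment> \<open>Only the summand of index \<open>n\<close> is unfolded: by construction it
      cancels the earlier ones and leaves the coefficient of the unit.\<close>
    also have "\<dots> = (if n = 0 then 1 else 0)"
      using assms(2) by (subst lessThan_Suc_atMost[symmetric], subst sum.lessThan_Suc,
        subst (2) linv_coeff.simps) (simp del: linv_coeff.simps)
    finally show ?thesis by (simp add: k)
  qed
  then have "lmul q b c = lsingle 0 1" by (intro laurent_eqI) (simp add: lcoeff_lsingle)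
  then show thesis using fil by (rule that)
qed

text \<open>The left inverse \<open>b\<close> of \<open>c\<close> has a left inverse
  \<open>a\<close> in turn, and \<open>a = a (b c) = (a b) c = c\<close>. So \<open>b\<close> is
  also a right inverse.\<close>

lemma lmul_inverse:
  fixes c :: "'k laurent"
  assumes "lfil m c" "lcoeff c m \<noteq> 0"
  obtains b where "lmul q b c = lsingle 0 1" "lmul q c b = lsingle 0 1" "lfil (- m) b"
proof -
  interpret fring "lmul q" "lsingle 0 1 :: 'k laurent" lfil by (rule lmul_fring)
  obtain b where b: "lmul q b c = lsingle 0 1" "lfil (- m) b"
    using assms by (rule lmul_left_inverse)
  have "b \<noteq> 0"
    using b(1) lcoeff_lsingle[of 0 "1 :: 'k" 0] by auto
  then obtain n where "lfil n b" "lcoeff b n \<noteq> 0" by (rule lfil_lead)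
  then obtain a where a: "lmul q a b = lsingle 0 1" by (rule lmul_left_inverse)
  have "a = c"
    using mul_assoc[of a b c] by (simp add: a b)
  with a b show thesis by (intro that) auto
qed

section \<open>Skew polynomials inside the Laurent series, from the left and from the right\<close>

lemma lpol_lmul:
  fixes a b :: "'k laurent"
  assumes "lpol a" "lpol b"
  shows "lpol (lmul q a b)"
proof -
  obtain A B where *: "lfil A a" "lfil B b" using lfil_bot by metis
  have "lcoeff a i * frz q (- i) (lcoeff b (k - i)) = 0" if "k > 0" for i k
    using assms that by (cases "i > 0") (auto simp: lpol_def)
  then show ?thesis unfolding lpol_def lcoeff_lmul[OF *] by (intro allI impI sum.neutral) blast
qed

lemma lpol_expand:
  assumes "lpol a" "lfil (- int n) a"
  shows "lcoeff a k = (\<Sum>i\<le>n. if k = - int i then lcoeff a k else 0)"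
proof (cases "- int n \<le> k \<and> k \<le> 0")
  case True
  then have "(\<Sum>i\<le>n. if k = - int i then lcoeff a k else 0) = (\<Sum>i\<in>{nat (- k)}. if k = - int i then lcoeff a k else 0)"
    by (intro sum.mono_neutral_right) auto
  with True show ?thesis by simp
next
  case False
  then have "lcoeff a k = 0" using assms by (auto simp: lpol_def lfil_def)
  then show ?thesis by (simp only: if_cancel sum.neutral_const)
qed

lemma truncate_lpol: "\<exists>b. lpol b \<and> lfil 1 (a - b)"
proof -
  obtain n where n: "lfil n a" using lfil_bot by blast
  define b where "b = Laurent (\<lambda>k. if k > 0 then 0 else lcoeff a k)"
  have "lcoeff b k = (if k > 0 then 0 else lcoeff a k)" for k
    unfolding b_def using n by (subst lcoeff_Laurent[of n]) (auto simp: lfil_def)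
  then show ?thesis by (intro exI[of _ b]) (auto simp: lpol_def lfil_def)
qed

lemma lmul_trunc_ring:
  "trunc_ring (lmul q) (lsingle 0 1 :: 'k laurent) lfil lpol lconst (\<lambda>n. lsingle (- int n) 1) (\<lambda>n. lsingle (int n) 1)"
proof (intro trunc_ring.intro lmul_fring trunc_ring_axioms.intro, goal_cases)
  case (3 a b)
  then show ?case by (rule lpol_lmul)
next
  case (7 a)
  show ?case by (rule truncate_lpol)
next
  case (11 a n)
  have "a = (\<Sum>i\<le>n. lmul q (lsingle 0 (lcoeff a (- int i))) (lsingle (- int i) 1))"
    by (rule laurent_eqI, subst lpol_expand[OF 11])
      (auto simp: lcoeff_sum lcoeff_lsingle_lmul lcoeff_lsingle intro!: sum.cong)
  then show ?case
    by (intro exI[of _ "\<lambda>i. lsingle 0 (lcoeff a (- int i))"]) (simp add: lconst_def lcoeff_lsingle)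
qed (auto simp: lpol_lmul lpol_def lconst_def lfil_def lcoeff_lsingle lcoeff_lsingle_lmul intro!: laurent_eqI)

text \<open>Constants now stand to the right of the powers of \<open>\<tau>\<close>. Moving a
  coefficient across \<open>\<tau> ^ i\<close> replaces it by its \<open>q ^ i\<close>-th root,
  which exists since the Frobenius map is surjective.\<close>

lemma lmul_trunc_ring_opposite:
  "trunc_ring (\<lambda>a b. lmul q b a) (lsingle 0 1 :: 'k laurent) lfil lpol lconst (\<lambda>n. lsingle (- int n) 1) (\<lambda>n. lsingle (int n) 1)"
proof (intro trunc_ring.intro fring.opposite_fring[OF lmul_fring] trunc_ring_axioms.intro, goal_cases)
  case (3 a b)
  then show ?case by (intro lpol_lmul)
next
  case (7 a)
  show ?case by (rule truncate_lpol)
next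
  case (10 n)
  show ?case by (rule laurent_eqI) (auto simp: lcoeff_lsingle_lmul lcoeff_lsingle)
next
  case (11 a n)
  have "a = (\<Sum>i\<le>n. lmul q (lsingle (- int i) 1) (lsingle 0 (frz q (- int i) (lcoeff a (- int i)))))"
    by (rule laurent_eqI, subst lpol_expand[OF 11])
      (auto simp: lcoeff_sum lcoeff_lsingle_lmul lcoeff_lsingle frz_frz intro!: sum.cong)
  then show ?case
    by (intro exI[of _ "\<lambda>i. lsingle 0 (frz q (- int i) (lcoeff a (- int i)))"])
      (simp add: lconst_def lcoeff_lsingle)
qed (auto simp: lpol_lmul lpol_def lconst_def lfil_def lcoeff_lsingle lcoeff_lsingle_lmul intro!: laurent_eqI)

end

section \<open>Opposite rings and transposition; diagonal matrices\<close>

context nring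
begin

lemma pmul_opposite: "nring.pmul (\<lambda>a b. b \<odot> a) f g = pmul g f"
proof -
  interpret op: nring "\<lambda>a b. b \<odot> a" unit by (rule opposite_nring)
  have "coeff (op.pmul f g) n = coeff (pmul g f) n" for n
    unfolding coeff_pmul op.coeff_pmul
    by (rule sum.reindex_bij_witness[of _ "\<lambda>i. n - i" "\<lambda>i. n - i"]) auto
  then show ?thesis by (simp add: poly_eq_iff)
qed

text \<open>Over a noncommutative ring, transposition reverses products only if the entries are
  multiplied in the opposite order as well.\<close>

lemma mm_opposite: "nring.mm (\<lambda>a b. b \<odot> a) d A B = (\<lambda>i j. mm d (\<lambda>i j. B j i) (\<lambda>i j. A j i) j i)"
proof -
  interpret op: nring "\<lambda>a b. b \<odot> a" unit by (rule opposite_nring)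
  show ?thesis by (auto simp: mm_def op.mm_def fun_eq_iff)
qed

lemma invertible_transpose:
  assumes "nring.invertible (mm d) (mone d) P"
  shows "nring.invertible (nring.mm (\<lambda>a b. b \<odot> a) d) (mone d) (\<lambda>i j. P j i)"
proof -
  interpret op: nring "\<lambda>a b. b \<odot> a" unit by (rule opposite_nring)
  interpret mat: nring "mm d" "mone d" by (rule mat_nring)
  interpret opmat: nring "op.mm d" "mone d" by (rule op.mat_nring)
  obtain P' where "mm d P P' = mone d" "mm d P' P = mone d"
    using assms unfolding mat.invertible_def by blast
  moreover have "(\<lambda>i j. mone d j i) = mone d" by (auto simp: mone_def fun_eq_iff)
  ultimately show ?thesis
    unfolding opmat.invertible_def by (intro exI[of _ "\<lambda>i j. P' j i"]) (simp add: mm_opposite)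
qed

lemma equivalent_transpose:
  assumes "nring.equivalent (mm d) (mone d) A B"
  shows "nring.equivalent (nring.mm (\<lambda>a b. b \<odot> a) d) (mone d) (\<lambda>i j. A j i) (\<lambda>i j. B j i)"
proof -
  interpret op: nring "\<lambda>a b. b \<odot> a" unit by (rule opposite_nring)
  interpret mat: nring "mm d" "mone d" by (rule mat_nring)
  interpret opmat: nring "op.mm d" "mone d" by (rule op.mat_nring)
  obtain P Q where "mat.invertible P" "mat.invertible Q" and B: "B = mm d (mm d P A) Q"
    using assms unfolding mat.equivalent_def by blast
  then have "opmat.invertible (\<lambda>i j. Q j i)" "opmat.invertible (\<lambda>i j. P j i)"
    by (simp_all add: invertible_transpose)
  moreover have "(\<lambda>i j. B j i) = op.mm d (op.mm d (\<lambda>i j. Q j i) (\<lambda>i j. A j i)) (\<lambda>i j. P j i)"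
    by (simp add: mm_opposite B mat.mul_assoc)
  ultimately show ?thesis unfolding opmat.equivalent_def by blast
qed

end

context fring
begin

lemma mat_good_cong:
  assumes "\<And>i j. i < d \<Longrightarrow> j < d \<Longrightarrow> A i j = B i j"
  shows "fring.good (mm d) (mone d) (mfil d) A \<longleftrightarrow> fring.good (mm d) (mone d) (mfil d) B"
proof -
  interpret mat: fring "mm d" "mone d" "mfil d" by (rule mat_fring)
  have "mfil d 1 (mone d - mm d X A) \<longleftrightarrow> mfil d 1 (mone d - mm d X B)" for X
    using assms by (auto simp: mfil_def mm_inside)
  then show ?thesis by (simp add: mat.good_def)
qed

text \<open>If \<open>x\<close> inverts the last entry up to a small error and that entry is
  \<open>h \<odot> c i\<close>, then \<open>x \<odot> h\<close> does the same for
  \<open>c i\<close>. Conversely, the last diagonal entry of the matrix condition is the condition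
  on \<open>c (d - 1)\<close>.\<close>

lemma mat_good_diagm:
  assumes "0 < d" and dvd: "\<And>i. i < d \<Longrightarrow> \<exists>h. c (d - 1) = h \<odot> c i"
  shows "fring.good (mm d) (mone d) (mfil d) (diagm d c) \<longleftrightarrow> good (c (d - 1))"
proof -
  interpret mat: fring "mm d" "mone d" "mfil d" by (rule mat_fring)
  show ?thesis
  proof
    assume "mat.good (diagm d c)"
    then obtain X where "mfil d 1 (mone d - mm d X (diagm d c))"
      unfolding mat.good_def by blast
    then have "fil 1 ((mone d - mm d X (diagm d c)) (d - 1) (d - 1))"
      using assms(1) by (simp add: mfil_def)
    then have "fil 1 (unit - X (d - 1) (d - 1) \<odot> c (d - 1))"
      using assms(1) by (simp add: mm_diagm_right mone_def)
    then show "good (c (d - 1))" unfolding good_def by blast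
  next
    assume "good (c (d - 1))"
    then obtain x where x: "fil 1 (unit - x \<odot> c (d - 1))" unfolding good_def by blast
    obtain h where h: "\<And>i. i < d \<Longrightarrow> c (d - 1) = h i \<odot> c i" using dvd by metis
    have "fil 1 ((mone d - mm d (diagm d (\<lambda>i. x \<odot> h i)) (diagm d c)) i j)" if "i < d" "j < d" for i j
    proof -
      have "(mone d - mm d (diagm d (\<lambda>i. x \<odot> h i)) (diagm d c)) i j
          = (if i = j then unit - x \<odot> (h i \<odot> c i) else 0)"
        using that by (simp add: mm_diagm mul_assoc) (simp add: diagm_def mone_def)
      moreover have "fil 1 (unit - x \<odot> (h i \<odot> c i))"
        using x h[OF that(1)] by simp
      ultimately show ?thesis by (simp only: split: if_split) simp
    qed
    then have "mfil d 1 (mone d - mm d (diagm d (\<lambda>i. x \<odot> h i)) (diagm d c))"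
      by (simp add: mfil_def)
    then show "mat.good (diagm d c)" unfolding mat.good_def by blast
  qed
qed

end

section \<open>Polynomials over the Laurent series and invariant factors\<close>

definition lrep :: "'k::field laurent poly \<Rightarrow> 'k lp" where
  "lrep p = (\<lambda>n. lcoeff (coeff p n))"

lemma lcoeff_0 [simp]: "lcoeff 0 = ls_zero"
  by (simp add: fun_eq_iff ls_zero_def)

lemma lcoeff_eq_ls_zero_iff [simp]: "lcoeff a = ls_zero \<longleftrightarrow> a = 0"
  by (metis lcoeff_0 lcoeff_inject)

lemma ls_valid_lcoeff:
  assumes "ls_valid c"
  obtains a where "c = lcoeff a"
  using assms Laurent_inverse[of c] by (metis mem_Collect_eq)

lemma lp_valid_obtain:
  assumes "lp_valid f"
  obtains p where "f = lrep p"
proof -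
  have "\<forall>n. \<exists>a. f n = lcoeff a" using assms ls_valid_lcoeff by (metis lp_valid_def)
  then obtain a where a: "\<And>n. f n = lcoeff (a n)" by metis
  obtain N where N: "\<And>n. f n \<noteq> ls_zero \<Longrightarrow> n < N"
    using assms finite_nat_set_iff_bounded[of "{n. f n \<noteq> ls_zero}"] by (auto simp: lp_valid_def)
  define p where "p = Poly (map a [0..<N])"
  have "coeff p n = a n" for n
    using N[of n] by (cases "n < N") (auto simp: p_def a nth_default_def)
  then have "f = lrep p" by (simp add: lrep_def a fun_eq_iff)
  then show thesis by (rule that)
qed

lemma lrep_inject: "lrep p = lrep p' \<longleftrightarrow> p = p'"
  by (auto simp: lrep_def poly_eq_iff fun_eq_iff intro!: laurent_eqI)

lemma lrep_0: "lrep 0 = lp_zero"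
  by (simp add: lrep_def lp_zero_def)

lemma lrep_add: "lrep (f + g) = lp_add (lrep f) (lrep g)"
  by (simp add: lrep_def lp_add_def ls_add_def fun_eq_iff)

lemma lrep_const: "lrep [:c:] = lp_const (lcoeff c)"
  by (auto simp: lrep_def lp_const_def fun_eq_iff coeff_pCons split: nat.splits)

text \<open>The condition on the Newton polygon in terms of valuations, in a form that does not
  distinguish left from right.\<close>

definition dominated :: "'k::field laurent poly \<Rightarrow> bool" where
  "dominated f \<longleftrightarrow> (\<exists>m. lfil m (coeff f 0) \<and> lcoeff (coeff f 0) m \<noteq> 0 \<and> (\<forall>i>0. lfil (m + 1) (coeff f i)))"

text \<open>Selects, among the coefficients of least valuation, the one of largest index. After
  scaling to valuation 0 and reduction modulo \<open>\<sigma>\<close> it would become the leading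
  coefficient.\<close>

lemma poly_lead:
  assumes "f \<noteq> (0 :: 'k::field laurent poly)"
  obtains m j where "\<And>i. lfil m (coeff f i)" "lcoeff (coeff f j) m \<noteq> 0" "\<And>i. j < i \<Longrightarrow> lcoeff (coeff f i) m = 0"
proof -
  define I where "I = {i. coeff f i \<noteq> 0}"
  have "finite I" unfolding I_def by (rule finite_subset[of _ "{..degree f}"]) (auto intro: le_degree)
  have "I \<noteq> {}" using assms by (auto simp: I_def poly_eq_iff)
  have "\<exists>m. lfil m (coeff f i) \<and> lcoeff (coeff f i) m \<noteq> 0" if "i \<in> I" for i
    using that lfil_lead[of "coeff f i"] by (auto simp: I_def)
  then obtain v where v: "\<And>i. i \<in> I \<Longrightarrow> lfil (v i) (coeff f i) \<and> lcoeff (coeff f i) (v i) \<noteq> 0" by metis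
  define m where "m = Min (v ` I)"
  have fil: "lfil m (coeff f i)" for i
  proof (cases "i \<in> I")
    case True
    then have "m \<le> v i" unfolding m_def using \<open>finite I\<close> by simp
    then show ?thesis using v[OF True] by (auto simp: lfil_def)
  qed (simp add: I_def lfil_def ls_zero_def)
  have "m \<in> v ` I" unfolding m_def using \<open>finite I\<close> \<open>I \<noteq> {}\<close> by (intro Min_in) auto
  define J where "J = {i. lcoeff (coeff f i) m \<noteq> 0}"
  have J: "finite J" "J \<noteq> {}"
    using \<open>m \<in> v ` I\<close> v by (auto simp: J_def I_def ls_zero_def intro!: finite_subset[OF _ \<open>finite I\<close>])
  have "lcoeff (coeff f (Max J)) m \<noteq> 0" using Max_in[OF J] by (simp add: J_def)
  moreover have "lcoeff (coeff f i) m = 0" if "Max J < i" for i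
    using that Max_ge[OF J(1), of i] by (force simp: J_def)
  ultimately show thesis using fil by (intro that)
qed

context frobenius_field
begin

sublocale L: trunc_ring "lmul q" "lsingle 0 1 :: 'k laurent" lfil lpol lconst
    "\<lambda>n. lsingle (- int n) 1" "\<lambda>n. lsingle (int n) 1"
  by (rule lmul_trunc_ring)

sublocale R: trunc_ring "\<lambda>a b. lmul q b a" "lsingle 0 1 :: 'k laurent" lfil lpol lconst
    "\<lambda>n. lsingle (- int n) 1" "\<lambda>n. lsingle (int n) 1"
  by (rule lmul_trunc_ring_opposite)

sublocale S: fring L.pmul "[:lsingle 0 1 :: 'k laurent:]" "\<lambda>n f. \<forall>i. lfil n (coeff f i)"
  by (rule L.poly_fring)

lemma lrep_pmul: "lrep (L.pmul f g) = lp_mult q (lrep f) (lrep g)"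
  by (simp add: lrep_def lp_mult_def fun_eq_iff L.coeff_pmul lcoeff_sum lcoeff_lmul')

text \<open>Gauss' lemma: the product of the coefficients of least valuation and, among these, of largest
  index is a coefficient of least valuation of the product, and modulo \<open>\<sigma>\<close> the only one is that
  of index 0.\<close>
lemma dominated_if_product:
  assumes "\<forall>i. lfil 1 (coeff ([:lsingle 0 1:] - L.pmul f g) i)"
  shows "dominated f \<and> dominated g"
proof -
  have P: "lcoeff (coeff (L.pmul f g) n) k = (if n = 0 \<and> k = 0 then 1 else 0)" if "k \<le> 0" for n k
  proof -
    have "lcoeff (coeff ([:lsingle 0 1:] - L.pmul f g) n) k = 0"
      using assms that unfolding lfil_def by force
    then show ?thesis
      by (cases n) (auto simp: lcoeff_lsingle)
  qed
  have "L.pmul f g \<noteq> 0" using P[of 0 0] by (auto simp: ls_zero_def)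
  then have "f \<noteq> 0" "g \<noteq> 0" by auto
  obtain m j where f: "\<And>i. lfil m (coeff f i)" "lcoeff (coeff f j) m \<noteq> 0" "\<And>i. j < i \<Longrightarrow> lcoeff (coeff f i) m = 0"
    using poly_lead[OF \<open>f \<noteq> 0\<close>] by blast
  obtain n l where g: "\<And>i. lfil n (coeff g i)" "lcoeff (coeff g l) n \<noteq> 0" "\<And>i. l < i \<Longrightarrow> lcoeff (coeff g i) n = 0"
    using poly_lead[OF \<open>g \<noteq> 0\<close>] by blast
  have lead: "lcoeff (coeff (L.pmul f g) k) (m + n)
      = (\<Sum>i\<le>k. lcoeff (coeff f i) m * frz q (- m) (lcoeff (coeff g (k - i)) n))" for k
    unfolding L.coeff_pmul lcoeff_sum using f(1) g(1) by (simp add: lcoeff_lmul_lead)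
  have "lcoeff (coeff (L.pmul f g) (j + l)) (m + n)
      = (\<Sum>i\<in>{j}. lcoeff (coeff f i) m * frz q (- m) (lcoeff (coeff g (j + l - i)) n))"
    unfolding lead
  proof (rule sum.mono_neutral_right)
    show "\<forall>i\<in>{..j + l} - {j}. lcoeff (coeff f i) m * frz q (- m) (lcoeff (coeff g (j + l - i)) n) = 0"
    proof
      fix i assume "i \<in> {..j + l} - {j}"
      then show "lcoeff (coeff f i) m * frz q (- m) (lcoeff (coeff g (j + l - i)) n) = 0"
        using f(3)[of i] g(3)[of "j + l - i"] by (cases "i < j") auto
    qed
  qed auto
  then have nz: "lcoeff (coeff (L.pmul f g) (j + l)) (m + n) \<noteq> 0"
    using f(2) g(2) by simp
  have "lfil (m + n) (coeff (L.pmul f g) 0)"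
    using S.fil_mul[of m f n g] f(1) g(1) by blast
  \<comment> \<open>The product has constant coefficient 1 modulo \<open>\<sigma>\<close>, so its
    least valuation cannot be positive. The coefficient found in degree \<open>j + l\<close> must
    then be this 1, which forces \<open>j = l = 0\<close>.\<close>
  then have "m + n \<le> 0"
    using P[of 0 0] by (intro leI notI) (simp add: lfil_def)
  then have "j = 0" "l = 0"
    using P[of "m + n" "j + l"] nz by (auto split: if_splits)
  moreover have "lfil (m + 1) (coeff f i)" if "i > j" for i
    using f(1)[of i] f(3)[OF that] by (auto simp: lfil_def le_less)
  moreover have "lfil (n + 1) (coeff g i)" if "i > l" for i
    using g(1)[of i] g(3)[OF that] by (auto simp: lfil_def le_less)
  ultimately show ?thesis
    unfolding dominated_def using f g by blast
qed

lemma coeff_const_pmul: "coeff (L.pmul [:c:] f) n = lmul q c (coeff f n)"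
proof -
  have "coeff (L.pmul [:c:] f) n = (\<Sum>i\<in>{0}. lmul q (coeff [:c:] i) (coeff f (n - i)))"
    unfolding L.coeff_pmul by (rule sum.mono_neutral_right) (auto simp: coeff_pCons split: nat.splits)
  then show ?thesis by simp
qed

lemma coeff_pmul_const: "coeff (L.pmul f [:c:]) n = lmul q (coeff f n) c"
proof -
  have "coeff (L.pmul f [:c:]) n = (\<Sum>i\<in>{n}. lmul q (coeff f i) (coeff [:c:] (n - i)))"
    unfolding L.coeff_pmul by (rule sum.mono_neutral_right) (auto simp: coeff_pCons split: nat.splits)
  then show ?thesis by simp
qed

text \<open>The inverse of the constant coefficient works on either side, since it moves all other
  coefficients to positive valuation.\<close>

lemma dominated_inverse:
  assumes "dominated f"
  obtains c where "\<forall>i. lfil 1 (coeff ([:lsingle 0 1:] - L.pmul [:c:] f) i)"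
    "\<forall>i. lfil 1 (coeff ([:lsingle 0 1:] - L.pmul f [:c:]) i)"
proof -
  obtain m where m: "lfil m (coeff f 0)" "lcoeff (coeff f 0) m \<noteq> 0" "\<And>i. i > 0 \<Longrightarrow> lfil (m + 1) (coeff f i)"
    using assms by (auto simp: dominated_def)
  obtain c where c: "lmul q c (coeff f 0) = lsingle 0 1" "lmul q (coeff f 0) c = lsingle 0 1" "lfil (- m) c"
    using lmul_inverse[OF m(1,2)] by blast
  have "lfil 1 (coeff ([:lsingle 0 1:] - L.pmul [:c:] f) i)" for i
    using c(1) lfil_lmul[OF c(3) m(3), of i]
    by (cases i) (auto simp: coeff_const_pmul lfil_zero intro: lfil_uminus)
  moreover have "lfil 1 (coeff ([:lsingle 0 1:] - L.pmul f [:c:]) i)" for i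
    using c(2) lfil_lmul[OF m(3) c(3), of i]
    by (cases i) (auto simp: coeff_pmul_const lfil_zero intro: lfil_uminus)
  ultimately show thesis using that by blast
qed

lemma good_iff_dominated: "S.good f \<longleftrightarrow> dominated f"
  unfolding S.good_def using dominated_if_product dominated_inverse by meson

text \<open>The opposite ring exchanges the factors, but Gauss' lemma gives the condition for both
  of them. This symmetry is the source of the equivalence of abelian and
  \<open>t\<close>-finite.\<close>

lemma good_opposite_iff_dominated:
  "fring.good R.pmul [:lsingle 0 1:] (\<lambda>n f. \<forall>i. lfil n (coeff f i)) f \<longleftrightarrow> dominated f"
proof -
  interpret SR: fring R.pmul "[:lsingle 0 1 :: 'k laurent:]" "\<lambda>n f. \<forall>i. lfil n (coeff f i)"
    by (rule R.poly_fring)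
  have "R.pmul f g = L.pmul g f" for f g
    by (rule L.pmul_opposite)
  then show ?thesis
    unfolding SR.good_def using dominated_if_product dominated_inverse by metis
qed

lemma invertible_const:
  assumes "c \<noteq> 0"
  shows "S.invertible [:c:]"
proof -
  obtain m where "lfil m c" "lcoeff c m \<noteq> 0" using assms by (rule lfil_lead)
  then obtain b where b: "lmul q b c = lsingle 0 1" "lmul q c b = lsingle 0 1"
    by (rule lmul_inverse)
  have "L.pmul [:c:] [:b:] = [:lsingle 0 1:]" "L.pmul [:b:] [:c:] = [:lsingle 0 1:]"
    using b by (auto simp: poly_eq_iff coeff_const_pmul coeff_pCons split: nat.splits)
  then show ?thesis unfolding S.invertible_def by blast
qed

text \<open>Every elementary operation is multiplication by an invertible matrix, from the left for
  rows and from the right for columns. Only the block is compared, because the entries outside it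
  are transformed differently.\<close>

lemma elem_reach_equivalent:
  assumes "elem_reach q d A B" "\<And>a b. a < d \<Longrightarrow> b < d \<Longrightarrow> A a b = lrep (A' a b)"
  shows "\<exists>B'. nring.equivalent (S.mm d) (S.mone d) A' B' \<and> (\<forall>a<d. \<forall>b<d. B a b = lrep (B' a b))"
proof -
  interpret mat: nring "S.mm d" "S.mone d" by (rule S.mat_nring)
  show ?thesis
    using assms(1)
  proof (induction rule: elem_reach.induct)
    case refl
    then show ?case using assms(2) mat.equivalent_refl by blast
  next
    case (row_swap B i j)
    then obtain B' where B': "mat.equivalent A' B'" "\<And>a b. a < d \<Longrightarrow> b < d \<Longrightarrow> B a b = lrep (B' a b)" by blast
    define s where "s a = (if a = i then j else if a = j then i else a)" for a
    have s: "\<And>a. a < d \<Longrightarrow> s a < d" "\<And>a. s (s a) = a"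
      using row_swap.hyps by (auto simp: s_def)
    have "mat.equivalent A' (S.mm d (S.involm d s) B')"
      using B'(1) S.invertible_involm[OF s] by (rule mat.equivalent_left)
    moreover have "(if a = i then B j b else if a = j then B i b else B a b) = lrep (S.mm d (S.involm d s) B' a b)"
      if "a < d" "b < d" for a b
      using that row_swap.hyps by (auto simp: S.mm_involm[OF s(1)] B'(2)) (auto simp: s_def B'(2))
    ultimately show ?case by blast
  next
    case (row_add B i j r)
    then obtain B' where B': "mat.equivalent A' B'" "\<And>a b. a < d \<Longrightarrow> b < d \<Longrightarrow> B a b = lrep (B' a b)" by blast
    obtain r' where r': "r = lrep r'" using lp_valid_obtain[OF \<open>lp_valid r\<close>] .
    have "mat.equivalent A' (S.mm d (S.addm d i j r') B')"
      using B'(1) S.invertible_addm[OF row_add.hyps(2-4)] by (rule mat.equivalent_left)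
    moreover have "(if a = i then lp_add (B i b) (lp_mult q r (B j b)) else B a b) = lrep (S.mm d (S.addm d i j r') B' a b)"
      if "a < d" "b < d" for a b
      using that row_add.hyps by (auto simp: S.mm_addm B'(2) lrep_add lrep_pmul r')
    ultimately show ?case by blast
  next
    case (row_scale B i c)
    then obtain B' where B': "mat.equivalent A' B'" "\<And>a b. a < d \<Longrightarrow> b < d \<Longrightarrow> B a b = lrep (B' a b)" by blast
    obtain c' where c': "c = lcoeff c'" using ls_valid_lcoeff[OF \<open>ls_valid c\<close>] .
    define e where "e a = (if a = i then [:c':] else [:lsingle 0 1:])" for a
    have "mat.invertible (S.diagm d e)"
      using \<open>c \<noteq> ls_zero\<close> by (intro S.invertible_diagm) (auto simp: e_def c' intro: invertible_const)
    then have "mat.equivalent A' (S.mm d (S.diagm d e) B')"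
      using B'(1) by (intro mat.equivalent_left)
    moreover have "(if a = i then lp_mult q (lp_const c) (B i b) else B a b) = lrep (S.mm d (S.diagm d e) B' a b)"
      if "a < d" "b < d" for a b
      using that row_scale.hyps
      by (cases "a = i") (simp_all add: S.mm_diagm B'(2) lrep_pmul lrep_const c' e_def)
    ultimately show ?case by blast
  next
    case (col_swap B i j)
    then obtain B' where B': "mat.equivalent A' B'" "\<And>a b. a < d \<Longrightarrow> b < d \<Longrightarrow> B a b = lrep (B' a b)" by blast
    define s where "s a = (if a = i then j else if a = j then i else a)" for a
    have s: "\<And>a. a < d \<Longrightarrow> s a < d" "\<And>a. s (s a) = a"
      using col_swap.hyps by (auto simp: s_def)
    have "mat.equivalent A' (S.mm d B' (S.involm d s))"
      using B'(1) S.invertible_involm[OF s] by (rule mat.equivalent_right)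
    moreover have "(if b = i then B a j else if b = j then B a i else B a b) = lrep (S.mm d B' (S.involm d s) a b)"
      if "a < d" "b < d" for a b
      using that col_swap.hyps by (auto simp: S.mm_involm_right[OF s] B'(2)) (auto simp: s_def B'(2))
    ultimately show ?case by blast
  next
    case (col_add B i j r)
    then obtain B' where B': "mat.equivalent A' B'" "\<And>a b. a < d \<Longrightarrow> b < d \<Longrightarrow> B a b = lrep (B' a b)" by blast
    obtain r' where r': "r = lrep r'" using lp_valid_obtain[OF \<open>lp_valid r\<close>] .
    \<comment> \<open>For columns the factor sits in row \<open>j\<close> and column
      \<open>i\<close>, the reverse of its position for rows.\<close>
    have "mat.equivalent A' (S.mm d B' (S.addm d j i r'))"
      using B'(1) S.invertible_addm[of j d i] col_add.hyps by (intro mat.equivalent_right) auto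
    moreover have "(if b = i then lp_add (B a i) (lp_mult q (B a j) r) else B a b) = lrep (S.mm d B' (S.addm d j i r') a b)"
      if "a < d" "b < d" for a b
      using that col_add.hyps by (auto simp: S.mm_addm_right B'(2) lrep_add lrep_pmul r')
    ultimately show ?case by blast
  next
    case (col_scale B i c)
    then obtain B' where B': "mat.equivalent A' B'" "\<And>a b. a < d \<Longrightarrow> b < d \<Longrightarrow> B a b = lrep (B' a b)" by blast
    obtain c' where c': "c = lcoeff c'" using ls_valid_lcoeff[OF \<open>ls_valid c\<close>] .
    define e where "e a = (if a = i then [:c':] else [:lsingle 0 1:])" for a
    have "mat.invertible (S.diagm d e)"
      using \<open>c \<noteq> ls_zero\<close> by (intro S.invertible_diagm) (auto simp: e_def c' intro: invertible_const)
    then have "mat.equivalent A' (S.mm d B' (S.diagm d e))"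
      using B'(1) by (intro mat.equivalent_right)
    moreover have "(if b = i then lp_mult q (B a i) (lp_const c) else B a b) = lrep (S.mm d B' (S.diagm d e) a b)"
      if "a < d" "b < d" for a b
      using that col_scale.hyps
      by (cases "b = i") (simp_all add: S.mm_diagm_right B'(2) lrep_pmul lrep_const c' e_def)
    ultimately show ?case by blast
  qed
qed

end

section \<open>The motive and the dual motive\<close>

definition emb :: "'k::field poly \<Rightarrow> 'k laurent" where
  "emb p = Laurent (ls_emb p)"

lemma lcoeff_emb: "lcoeff (emb p) = ls_emb p"
  unfolding emb_def
  by (rule lcoeff_Laurent[of "- int (degree p)"]) (auto simp: ls_emb_def intro!: coeff_eq_0)

lemma emb_0 [simp]: "emb 0 = 0"
  by (rule laurent_eqI) (simp add: lcoeff_emb ls_emb_def ls_zero_def)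

lemma emb_add: "emb (p + r) = emb p + emb r"
  by (rule laurent_eqI) (simp add: lcoeff_emb ls_emb_def)

lemma emb_sum: "emb (\<Sum>i\<in>I. f i) = (\<Sum>i\<in>I. emb (f i))"
  by (induction I rule: infinite_finite_induct) (auto simp: emb_add)

lemma emb_inject [simp]: "emb p = emb r \<longleftrightarrow> p = r"
proof
  assume "emb p = emb r"
  then have "lcoeff (emb p) (- int n) = lcoeff (emb r) (- int n)" for n by simp
  then show "p = r" by (simp add: lcoeff_emb ls_emb_def poly_eq_iff)
qed simp

lemma emb_eq_0_iff [simp]: "emb p = 0 \<longleftrightarrow> p = 0"
  using emb_inject[of p 0] by simp

lemma lpol_emb: "lpol (emb p)"
  by (simp add: lpol_def lcoeff_emb ls_emb_def)

lemma lpol_obtain: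
  assumes "lpol a"
  obtains p where "a = emb p"
proof -
  obtain N where N: "lfil N a" using lfil_bot by blast
  define p where "p = Poly (map (\<lambda>n. lcoeff a (- int n)) [0..<nat (1 - N)])"
  have "coeff p n = lcoeff a (- int n)" for n
    using N by (cases "n < nat (1 - N)") (auto simp: p_def nth_default_def lfil_def)
  then have "a = emb p"
    using assms by (intro laurent_eqI) (auto simp: lcoeff_emb ls_emb_def lpol_def)
  then show thesis by (rule that)
qed

lemma lconst_emb: "lconst (emb [:c:])"
  by (auto simp: lconst_def lcoeff_emb ls_emb_def coeff_pCons split: nat.splits)

lemma lconst_obtain:
  assumes "lconst a"
  obtains c where "a = emb [:c:]"
proof -
  have "a = emb [:lcoeff a 0:]"
    using assms
    by (intro laurent_eqI) (auto simp: lcoeff_emb ls_emb_def lconst_def coeff_pCons split: nat.splits)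
  then show thesis by (rule that)
qed

text \<open>Treats both motives at once: \<open>act\<close> only has to match, under
  \<open>emb\<close>, the action on rows for some product \<open>mul\<close>. An arbitrary bound
  \<open>N\<close> in place of the degree lets the polynomials attached to different generators
  share one bound.\<close>

lemma fin_gen_K_t_iff:
  fixes mul :: "'k::field laurent \<Rightarrow> 'k laurent \<Rightarrow> 'k laurent"
  assumes "trunc_ring mul unit lfil lpol lconst u s"
    and act: "\<And>f m N. degree f \<le> N \<Longrightarrow> (\<lambda>j. emb (act f m j)) =
      (\<Sum>n\<le>N. nring.lscale mul (emb [:coeff f n:]) ((nring.rt mul d D ^^ n) (\<lambda>j. emb (m j))))"
  shows "fin_gen_K_t d act \<longleftrightarrow> trunc_ring.fin_gen mul lpol lconst d D"
proof -
  interpret X: trunc_ring mul unit lfil lpol lconst u s by fact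
  define er :: "'k skvec \<Rightarrow> nat \<Rightarrow> 'k laurent" where "er m = (\<lambda>j. emb (m j))" for m
  have T_row_er: "X.T_row d (er m)" if "vec_supp d m" for m
    using that by (auto simp: X.T_row_def er_def vec_supp_def lpol_emb)
  have er_inject: "m = m'" if "er m = er m'" for m m'
    using that by (auto simp: er_def fun_eq_iff)
  have er_surj: "\<exists>m. vec_supp d m \<and> v = er m" if "X.T_row d v" for v
  proof -
    have "\<forall>j. \<exists>p. v j = emb p" using that lpol_obtain unfolding X.T_row_def by metis
    then obtain m where "\<And>j. v j = emb (m j)" by metis
    moreover from this have "vec_supp d m"
      using that by (simp add: vec_supp_def X.T_row_def)
    ultimately show ?thesis by (auto simp: er_def fun_eq_iff)
  qed
  have act_er: "er (act f m) = (\<Sum>n\<le>N. X.lscale (emb [:coeff f n:]) ((X.rt d D ^^ n) (er m)))"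
    if "degree f \<le> N" for f m N
    using act[OF that] by (simp add: er_def)
  have er_sum: "er (\<lambda>j. \<Sum>i\<in>I. f i j) = (\<Sum>i\<in>I. er (f i))" for f and I :: "nat set"
    by (rule ext) (simp add: er_def emb_sum X.sum_apply)
  show ?thesis
  proof
    assume "fin_gen_K_t d act"
    then obtain gs where gs: "\<forall>g\<in>set gs. vec_supp d g"
      and span: "\<And>m. vec_supp d m \<Longrightarrow>
        \<exists>fs. length fs = length gs \<and> m = (\<lambda>j. \<Sum>k<length gs. act (fs ! k) (gs ! k) j)"
      unfolding fin_gen_K_t_def by blast
    have "\<exists>N c. (\<forall>k n. lconst (c k n)) \<and>
        v = (\<Sum>k<length (map er gs). \<Sum>n\<le>N. X.lscale (c k n) ((X.rt d D ^^ n) (map er gs ! k)))"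
      if v: "X.T_row d v" for v
    proof -
      obtain m where m: "vec_supp d m" "v = er m" using er_surj[OF v] by blast
      obtain fs where fs: "length fs = length gs" "m = (\<lambda>j. \<Sum>k<length gs. act (fs ! k) (gs ! k) j)"
        using span[OF m(1)] by blast
      define N where "N = Max (insert 0 (degree ` set fs))"
      have N: "degree (fs ! k) \<le> N" if "k < length gs" for k
        using that fs(1) unfolding N_def by (intro Max_ge) auto
      have "v = (\<Sum>k<length gs. er (act (fs ! k) (gs ! k)))"
        by (simp only: m(2) fs(2) er_sum)
      also have "\<dots> = (\<Sum>k<length gs. \<Sum>n\<le>N. X.lscale (emb [:coeff (fs ! k) n:]) ((X.rt d D ^^ n) (map er gs ! k)))"
      proof (rule sum.cong)
        fix k assume "k \<in> {..<length gs}"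
        then have k: "k < length gs" by simp
        show "er (act (fs ! k) (gs ! k)) = (\<Sum>n\<le>N. X.lscale (emb [:coeff (fs ! k) n:]) ((X.rt d D ^^ n) (map er gs ! k)))"
          unfolding nth_map[OF k] by (rule act_er[OF N[OF k]])
      qed simp
      finally have "v = (\<Sum>k<length gs. \<Sum>n\<le>N. X.lscale (emb [:coeff (fs ! k) n:]) ((X.rt d D ^^ n) (map er gs ! k)))" .
      then show ?thesis
        by (intro exI[of _ N] exI[of _ "\<lambda>k n. emb [:coeff (fs ! k) n:]"]) (simp add: lconst_emb)
    qed
    moreover have "\<forall>g\<in>set (map er gs). X.T_row d g" using gs T_row_er by auto
    ultimately show "X.fin_gen d D" unfolding X.fin_gen_def by blast
  next
    assume "X.fin_gen d D"
    then obtain hs where hs: "\<forall>g\<in>set hs. X.T_row d g"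
      and span: "\<And>v. X.T_row d v \<Longrightarrow> \<exists>N c. (\<forall>k n. lconst (c k n)) \<and>
        v = (\<Sum>k<length hs. \<Sum>n\<le>N. X.lscale (c k n) ((X.rt d D ^^ n) (hs ! k)))"
      unfolding X.fin_gen_def by blast
    obtain r where r: "\<And>v. X.T_row d v \<Longrightarrow> vec_supp d (r v) \<and> v = er (r v)"
      using er_surj by metis
    define gs where "gs = map r hs"
    have "\<forall>g\<in>set gs. vec_supp d g" using hs r by (auto simp: gs_def)
    moreover have "\<exists>fs. length fs = length gs \<and> m = (\<lambda>j. \<Sum>k<length gs. act (fs ! k) (gs ! k) j)"
      if m: "vec_supp d m" for m
    proof -
      obtain N c where c: "\<And>k n. lconst (c k n)"
        and eq: "er m = (\<Sum>k<length hs. \<Sum>n\<le>N. X.lscale (c k n) ((X.rt d D ^^ n) (hs ! k)))"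
        using span[OF T_row_er[OF m]] by blast
      have "\<forall>k n. \<exists>x. c k n = emb [:x:]" using c lconst_obtain by metis
      then obtain x where x: "\<And>k n. c k n = emb [:x k n:]" by metis
      define f where "f k = Poly (map (x k) [0..<Suc N])" for k
      have coeff_f: "coeff (f k) n = (if n \<le> N then x k n else 0)" for k n
        by (auto simp: f_def nth_default_def simp del: upt_Suc)
      have deg: "degree (f k) \<le> N" for k
        by (rule degree_le) (simp add: coeff_f)
      have hs_k: "er (r (hs ! k)) = hs ! k" if "k < length hs" for k
        using r hs that by simp
      have "er m = (\<Sum>k<length hs. er (act (f k) (r (hs ! k))))"
        unfolding eq
      proof (rule sum.cong)
        fix k assume "k \<in> {..<length hs}"
        then have k: "er (r (hs ! k)) = hs ! k" using hs_k by simp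
        have "c k n = emb [:coeff (f k) n:]" if "n \<le> N" for n
          using that by (simp add: coeff_f x)
        then show "(\<Sum>n\<le>N. X.lscale (c k n) ((X.rt d D ^^ n) (hs ! k))) = er (act (f k) (r (hs ! k)))"
          unfolding act_er[OF deg] k by (intro sum.cong) auto
      qed simp
      then have "er m = er (\<lambda>j. \<Sum>k<length hs. act (f k) (r (hs ! k)) j)"
        by (simp only: er_sum)
      then have "m = (\<lambda>j. \<Sum>k<length hs. act (f k) (r (hs ! k)) j)" by (rule er_inject)
      then show ?thesis
        by (intro exI[of _ "map f [0..<length hs]"]) (simp add: gs_def)
    qed
    ultimately show "fin_gen_K_t d act" unfolding fin_gen_K_t_def by blast
  qed
qed

text \<open>For \<open>q = 0\<close> the power \<open>0 ^ q ^ i\<close> with \<open>i > 0\<close>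
  would be 1, and coefficients beyond the degree of \<open>b\<close> would contribute.\<close>

lemma coeff_skmult: "coeff (skmult q a b) n = (\<Sum>i\<le>n. coeff a i * coeff b (n - i) ^ q ^ i)"
  if "0 < q" for a b :: "'k::field poly"
proof (cases "n < degree a + degree b + 1")
  case True
  then show ?thesis by (simp add: skmult_def nth_default_def del: upt_Suc)
next
  case False
  have "coeff a i * coeff b (n - i) ^ q ^ i = 0" if "i \<le> n" for i
    using False that \<open>0 < q\<close> by (cases "i \<le> degree a") (simp_all add: coeff_eq_0)
  then have "(\<Sum>i\<le>n. coeff a i * coeff b (n - i) ^ q ^ i) = 0" by (intro sum.neutral) auto
  then show ?thesis using False by (simp add: skmult_def nth_default_def del: upt_Suc)
qed

context frobenius_field
begin

lemma q_pos: "0 < q"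
proof (rule ccontr)
  assume "\<not> 0 < q"
  then have "frobq q (0 :: 'k) = frobq q 1" by (simp add: frobq_def)
  then show False using bij_is_inj[OF frobq_bij] by (simp add: inj_eq)
qed

lemma emb_skmult: "emb (skmult q a b :: 'k poly) = lmul q (emb a) (emb b)"
proof (rule laurent_eqI)
  fix k
  show "lcoeff (emb (skmult q a b)) k = lcoeff (lmul q (emb a) (emb b)) k"
  proof (cases "k > 0")
    case True
    then show ?thesis
      using lpol_lmul[OF lpol_emb[of a] lpol_emb[of b]] lpol_emb[of "skmult q a b"] by (simp add: lpol_def)
  next
    case False
    define n where "n = nat (- k)"
    have k: "k = - int n" using False by (simp add: n_def)
    obtain A' B' where AB': "lfil A' (emb a)" "lfil B' (emb b)" using lfil_bot by metis
    \<comment> \<open>Lowering the bounds ensures that the interval of summation contains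
      \<open>{k..0}\<close>, outside of which one of the two factors vanishes.\<close>
    define A B where "A = min A' k" and "B = min B' k"
    have AB: "lfil A (emb a)" "lfil B (emb b)" "A \<le> k" "B \<le> k"
      using AB' by (auto simp: A_def B_def intro: lfil_mono)
    have "lcoeff (lmul q (emb a) (emb b)) k
        = (\<Sum>i\<in>{A..k - B}. lcoeff (emb a) i * frz q (- i) (lcoeff (emb b) (k - i)))"
      by (rule lcoeff_lmul[OF AB(1,2)])
    also have "\<dots> = (\<Sum>i\<in>{k..0}. lcoeff (emb a) i * frz q (- i) (lcoeff (emb b) (k - i)))"
      using AB(3,4) by (intro sum.mono_neutral_right) (auto simp: lcoeff_emb ls_emb_def)
    also have "\<dots> = (\<Sum>i\<le>n. coeff a i * coeff b (n - i) ^ q ^ i)"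
    proof -
      have *: "nat (i + int n) = n - nat (- i)" if "- int n \<le> i" "i \<le> 0" for i
        using that by linarith
      show ?thesis
      by (rule sum.reindex_bij_witness[of _ "\<lambda>i. - int i" "\<lambda>i. nat (- i)"])
        (auto simp: k lcoeff_emb ls_emb_def * frz_nat[symmetric])
    qed
    finally show ?thesis
      by (simp add: lcoeff_emb ls_emb_def k coeff_skmult[OF q_pos])
  qed
qed

lemma emb_row_times:
  "(\<lambda>j. emb (row_times q d m D j)) = L.rt d (\<lambda>i j. emb (D i j)) (\<lambda>j. emb (m j :: 'k poly))"
  by (simp add: row_times_def L.rt_def emb_sum emb_skmult fun_eq_iff)

lemma emb_row_times_pow:
  "(\<lambda>j. emb (((\<lambda>v. row_times q d v D) ^^ n) m j)) = (L.rt d (\<lambda>i j. emb (D i j)) ^^ n) (\<lambda>j. emb (m j :: 'k poly))"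
  by (induction n) (simp_all add: emb_row_times)

text \<open>A matrix acting on columns becomes the transposed matrix acting on rows over the
  opposite ring.\<close>

lemma emb_mat_times:
  "(\<lambda>i. emb (mat_times q d D m i)) = R.rt d (\<lambda>i j. emb (D j i)) (\<lambda>j. emb (m j :: 'k poly))"
  by (simp add: mat_times_def R.rt_def emb_sum emb_skmult fun_eq_iff)

lemma emb_mat_times_pow:
  "(\<lambda>i. emb (((\<lambda>v. mat_times q d D v) ^^ n) m i)) = (R.rt d (\<lambda>i j. emb (D j i)) ^^ n) (\<lambda>j. emb (m j :: 'k poly))"
  by (induction n) (simp_all add: emb_mat_times)

lemma skmult_0_left: "skmult q 0 (b :: 'k poly) = 0"
  by (simp add: poly_eq_iff coeff_skmult[OF q_pos])

lemma skmult_0_right: "skmult q (b :: 'k poly) 0 = 0"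
  using q_pos by (simp add: poly_eq_iff coeff_skmult[OF q_pos] power_0_left)

lemma abelian_iff: "abelian q d (D :: 'k skmat) \<longleftrightarrow> L.fin_gen d (\<lambda>i j. emb (D i j))"
  unfolding abelian_def
proof (rule fin_gen_K_t_iff[OF lmul_trunc_ring])
  fix f :: "'k poly" and m N
  assume N: "degree f \<le> N"
  have "motive_act q d D f m j = (\<Sum>n\<le>N. skmult q [:coeff f n:] (((\<lambda>v. row_times q d v D) ^^ n) m j))" for j
    unfolding motive_act_def using N
    by (intro sum.mono_neutral_left) (auto simp: coeff_eq_0 skmult_0_left)
  then show "(\<lambda>j. emb (motive_act q d D f m j)) =
      (\<Sum>n\<le>N. L.lscale (emb [:coeff f n:]) ((L.rt d (\<lambda>i j. emb (D i j)) ^^ n) (\<lambda>j. emb (m j))))"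
    unfolding emb_row_times_pow[symmetric] fun_eq_iff L.sum_apply
    by (simp add: emb_sum emb_skmult L.lscale_def)
qed

lemma t_finite_iff: "t_finite q d (D :: 'k skmat) \<longleftrightarrow> R.fin_gen d (\<lambda>i j. emb (D j i))"
  unfolding t_finite_def
proof (rule fin_gen_K_t_iff[OF lmul_trunc_ring_opposite])
  fix f :: "'k poly" and m N
  assume N: "degree f \<le> N"
  have "dual_motive_act q d D f m j = (\<Sum>n\<le>N. skmult q (((\<lambda>v. mat_times q d D v) ^^ n) m j) [:coeff f n:])" for j
    unfolding dual_motive_act_def using N
    by (intro sum.mono_neutral_left) (auto simp: coeff_eq_0 skmult_0_right)
  then show "(\<lambda>j. emb (dual_motive_act q d D f m j)) =
      (\<Sum>n\<le>N. R.lscale (emb [:coeff f n:]) ((R.rt d (\<lambda>i j. emb (D j i)) ^^ n) (\<lambda>j. emb (m j))))"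
    unfolding emb_mat_times_pow[symmetric] fun_eq_iff L.sum_apply
    by (simp add: emb_sum emb_skmult R.lscale_def)
qed

lemma char_mat_eq: "a < d \<Longrightarrow> b < d \<Longrightarrow> char_mat d (D :: 'k skmat) a b = lrep (L.charm (\<lambda>i j. emb (D i j)) a b)"
  by (auto simp: char_mat_def lrep_def L.charm_def lp_sub_def lp_X_def lp_const_def lp_zero_def fun_eq_iff
      ls_add_def ls_neg_def ls_zero_def ls_one_def coeff_pCons lcoeff_emb lcoeff_lsingle split: nat.splits)

text \<open>Divisibility between neighbours is composed along the chain up to the last factor,
  separately for each side: \<open>abelian\<close> uses right divisors, \<open>t_finite\<close> left
  ones.\<close>

lemma last_invariant_factor_obtain:
  assumes "last_invariant_factor q d (D :: 'k skmat) lam" "0 < d"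
  obtains B c where "nring.equivalent (S.mm d) (S.mone d) (L.charm (\<lambda>i j. emb (D i j))) B"
    "\<And>i j. i < d \<Longrightarrow> j < d \<Longrightarrow> B i j = (if i = j then c i else 0)"
    "\<And>i. i < d \<Longrightarrow> \<exists>h. c (d - 1) = L.pmul h (c i)"
    "\<And>i. i < d \<Longrightarrow> \<exists>h. c (d - 1) = L.pmul (c i) h"
    "lam = lrep (c (d - 1))"
proof -
  obtain B \<Lambda> where "elem_reach q d (char_mat d D) B \<and>
      (\<forall>a<d. \<forall>b<d. B a b = (if a = b then \<Lambda> a else lp_zero)) \<and>
      (\<forall>i<d. lp_monic (\<Lambda> i)) \<and>
      (\<forall>i. i + 1 < d \<longrightarrow> lp_left_dvd q (\<Lambda> i) (\<Lambda> (i + 1)) \<and> lp_right_dvd q (\<Lambda> i) (\<Lambda> (i + 1))) \<and>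
      lam = \<Lambda> (d - 1)"
    using assms(1) unfolding last_invariant_factor_def by (elim exE) (rule that)
  then have B: "elem_reach q d (char_mat d D) B"
    and diag: "\<And>a b. a < d \<Longrightarrow> b < d \<Longrightarrow> B a b = (if a = b then \<Lambda> a else lp_zero)"
    and dvd: "\<And>i. i + 1 < d \<Longrightarrow> lp_left_dvd q (\<Lambda> i) (\<Lambda> (i + 1))"
      "\<And>i. i + 1 < d \<Longrightarrow> lp_right_dvd q (\<Lambda> i) (\<Lambda> (i + 1))"
    and lam: "lam = \<Lambda> (d - 1)"
    by simp_all
  obtain B' where B': "nring.equivalent (S.mm d) (S.mone d) (L.charm (\<lambda>i j. emb (D i j))) B'"
    "\<And>a b. a < d \<Longrightarrow> b < d \<Longrightarrow> B a b = lrep (B' a b)"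
    using elem_reach_equivalent[OF B char_mat_eq] by blast
  define c where "c i = B' i i" for i
  have \<Lambda>: "\<Lambda> i = lrep (c i)" if "i < d" for i
    using diag[OF that that] B'(2)[OF that that] by (simp add: c_def)
  have B'_diag: "B' i j = (if i = j then c i else 0)" if "i < d" "j < d" for i j
    using diag[OF that] B'(2)[OF that] by (auto simp: c_def lrep_0[symmetric] lrep_inject)
  have right: "\<exists>h. c (Suc i) = L.pmul h (c i)" if "Suc i < d" for i
  proof -
    obtain h where h: "lp_valid h" "\<Lambda> (i + 1) = lp_mult q h (\<Lambda> i)"
      using dvd(2)[of i] \<open>Suc i < d\<close> by (auto simp: lp_right_dvd_def)
    obtain h' where "h = lrep h'" using h(1) by (rule lp_valid_obtain)
    with h(2) that have "lrep (c (Suc i)) = lrep (L.pmul h' (c i))"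
      by (simp add: \<Lambda> lrep_pmul)
    then show ?thesis by (auto simp: lrep_inject)
  qed
  have left: "\<exists>h. c (Suc i) = L.pmul (c i) h" if "Suc i < d" for i
  proof -
    obtain h where h: "lp_valid h" "\<Lambda> (i + 1) = lp_mult q (\<Lambda> i) h"
      using dvd(1)[of i] \<open>Suc i < d\<close> by (auto simp: lp_left_dvd_def)
    obtain h' where "h = lrep h'" using h(1) by (rule lp_valid_obtain)
    with h(2) that have "lrep (c (Suc i)) = lrep (L.pmul (c i) h')"
      by (simp add: \<Lambda> lrep_pmul)
    then show ?thesis by (auto simp: lrep_inject)
  qed
  have "\<exists>h. c (d - 1) = L.pmul h (c i)" if "i \<le> d - 1" for i
    using that
  proof (induction rule: inc_induct)
    case base
    show ?case by (rule exI[of _ "[:lsingle 0 1:]"]) simp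
  next
    case (step n)
    then obtain h where h: "c (d - 1) = L.pmul h (c (Suc n))" by blast
    obtain h' where "c (Suc n) = L.pmul h' (c n)"
      using right[of n] step.hyps by (auto simp: less_diff_conv)
    with h have "c (d - 1) = L.pmul (L.pmul h h') (c n)" by (simp add: S.mul_assoc)
    then show ?case ..
  qed
  moreover have "\<exists>h. c (d - 1) = L.pmul (c i) h" if "i \<le> d - 1" for i
    using that
  proof (induction rule: inc_induct)
    case base
    show ?case by (rule exI[of _ "[:lsingle 0 1:]"]) simp
  next
    case (step n)
    then obtain h where h: "c (d - 1) = L.pmul (c (Suc n)) h" by blast
    obtain h' where "c (Suc n) = L.pmul (c n) h'"
      using left[of n] step.hyps by (auto simp: less_diff_conv)
    with h have "c (d - 1) = L.pmul (c n) (L.pmul h' h)" by (simp add: S.mul_assoc)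
    then show ?case ..
  qed
  moreover have "lam = lrep (c (d - 1))"
    using lam \<Lambda>[of "d - 1"] assms(2) by simp
  moreover have "i < d \<Longrightarrow> i \<le> d - 1" for i by simp
  ultimately show thesis by (intro that[OF B'(1) B'_diag]) auto
qed

end

section \<open>Newton polygons\<close>

text \<open>A line lying below all points lies below all their convex combinations.\<close>

lemma newton_slope_bound:
  fixes w :: "nat \<Rightarrow> real" and c :: "nat \<Rightarrow> real"
  assumes "\<And>i. c i \<ge> 0" "(\<Sum>i\<in>I. c i) = 1" "(\<Sum>i\<in>I. c i * real i) = y"
    and "\<And>i. i \<in> I \<Longrightarrow> w0 + e * real i \<le> w i"
  shows "w0 + e * y \<le> (\<Sum>i\<in>I. c i * w i)"
proof -
  have "w0 + e * y = (\<Sum>i\<in>I. c i * (w0 + e * real i))"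
    by (simp add: algebra_simps sum.distrib assms(3)[symmetric] sum_distrib_left[symmetric] assms(2))
  also have "\<dots> \<le> (\<Sum>i\<in>I. c i * w i)"
    using assms by (intro sum_mono mult_left_mono) auto
  finally show ?thesis .
qed

text \<open>The polygon starts at \<open>w 0\<close> and passes below every point, so if it
  increases strictly, all other points lie higher than the first. Conversely, the points then lie
  above a line of positive slope \<open>e\<close> through the first one, and by convexity the
  polygon rises at least at rate \<open>e\<close> everywhere.\<close>

lemma NP_positive_slopes_iff:
  assumes "lp_monic f"
  shows "NP_positive_slopes f \<longleftrightarrow> f 0 \<noteq> ls_zero \<and> (\<forall>i>0. f i \<noteq> ls_zero \<longrightarrow> ls_val (f 0) < ls_val (f i))"
proof (cases "f 0 = ls_zero")
  case False
  define n where "n = lp_degree f"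
  define I where "I = {i. i \<le> n \<and> f i \<noteq> ls_zero}"
  define w where "w i = real_of_int (ls_val (f i))" for i
  define V where "V x = {\<Sum>i\<in>I. c i * w i | c. (\<forall>i. c i \<ge> 0) \<and> (\<Sum>i\<in>I. c i) = 1 \<and> (\<Sum>i\<in>I. c i * real i) = x}" for x
  have NP: "newton_polygon f x = Inf (V x)" for x
    by (simp add: newton_polygon_def V_def I_def n_def w_def)
  obtain N where N: "f N = ls_one" "\<And>m. m > N \<Longrightarrow> f m = ls_zero"
    using assms by (auto simp: lp_monic_def)
  have "f N \<noteq> ls_zero" unfolding N by (auto simp: ls_one_def ls_zero_def fun_eq_iff)
  then have "n = N"
    unfolding n_def lp_degree_def using N(2) by (intro Greatest_equality) (auto intro: leI)
  have finI: "finite I" by (simp add: I_def)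
  have I0: "0 \<in> I" and In: "n \<in> I"
    using False \<open>f N \<noteq> ls_zero\<close> \<open>n = N\<close> by (auto simp: I_def)
  have I_iff: "i \<in> I \<longleftrightarrow> f i \<noteq> ls_zero" for i
    using N(2) \<open>n = N\<close> by (auto simp: I_def intro: leI)
  have pt: "w i \<in> V (real i)" if "i \<in> I" for i
    unfolding V_def using that finI
    by (intro CollectI exI[of _ "\<lambda>j. if j = i then 1 else 0"]) (auto simp: if_distrib[of "\<lambda>x. x * _"] cong: if_cong)
  \<comment> \<open>The combinations form a convex set; only segments issuing from the first point
    are needed.\<close>
  have segment: "(1 - s) * w 0 + s * v \<in> V (s * y)" if s: "0 \<le> s" "s \<le> 1" and v: "v \<in> V y" for s v y
  proof -
    obtain c where c: "\<forall>i. c i \<ge> 0" "(\<Sum>i\<in>I. c i) = 1" "(\<Sum>i\<in>I. c i * real i) = y" "v = (\<Sum>i\<in>I. c i * w i)"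
      using v by (auto simp: V_def)
    define c' where "c' i = (if i = 0 then 1 - s else 0) + s * c i" for i
    have "(\<Sum>i\<in>I. c' i * g i) = (1 - s) * g 0 + s * (\<Sum>i\<in>I. c i * g i)" for g
    proof -
      have "(\<Sum>i\<in>I. c' i * g i) = (\<Sum>i\<in>I. (if i = 0 then (1 - s) * g 0 else 0) + s * (c i * g i))"
        by (intro sum.cong) (auto simp: c'_def algebra_simps)
      then show ?thesis using finI I0 by (simp add: sum.distrib sum_distrib_left)
    qed
    from this[of w] this[of real] this[of "\<lambda>_. 1"] show ?thesis
      unfolding V_def using s c by (intro CollectI exI[of _ c']) (auto simp: c'_def)
  qed
  have bdd: "bdd_below (V x)" for x
  proof
    fix v assume "v \<in> V x"
    then obtain c where c: "\<forall>i. c i \<ge> 0" "(\<Sum>i\<in>I. c i) = 1" "(\<Sum>i\<in>I. c i * real i) = x" "v = (\<Sum>i\<in>I. c i * w i)"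
      by (auto simp: V_def)
    have "Min (w ` I) + 0 * x \<le> v"
      unfolding c(4) using finI c by (intro newton_slope_bound) auto
    then show "Min (w ` I) \<le> v" by simp
  qed
  have "strict_mono_on {0..real n} (newton_polygon f) \<longleftrightarrow> (\<forall>i>0. i \<in> I \<longrightarrow> w 0 < w i)"
  proof
    assume mono: "strict_mono_on {0..real n} (newton_polygon f)"
    have NP_0: "newton_polygon f 0 = w 0"
    proof -
      have "v = w 0" if v: "v \<in> V 0" for v
      proof -
        obtain c where c: "\<forall>i. c i \<ge> 0" "(\<Sum>i\<in>I. c i) = 1" "(\<Sum>i\<in>I. c i * real i) = 0" "v = (\<Sum>i\<in>I. c i * w i)"
          using v by (auto simp: V_def)
        then have "\<forall>i\<in>I. c i * real i = 0"
          using finI by (subst (asm) sum_nonneg_eq_0_iff) auto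
        then have "c i = 0" if "i \<in> I" "i \<noteq> 0" for i using that by auto
        then have "(\<Sum>i\<in>I. c i * g i) = (\<Sum>i\<in>{0}. c i * g i)" for g
          using finI I0 by (intro sum.mono_neutral_right) auto
        from this[of w] this[of "\<lambda>_. 1"] show ?thesis using c by simp
      qed
      moreover have "w 0 \<in> V 0" using pt[OF I0] by simp
      ultimately have "V 0 = {w 0}" by blast
      then show ?thesis by (simp add: NP)
    qed
    have NP_le: "newton_polygon f (real i) \<le> w i" if "i \<in> I" for i
      unfolding NP using pt[OF that] bdd by (rule cInf_lower)
    show "\<forall>i>0. i \<in> I \<longrightarrow> w 0 < w i"
    proof (intro allI impI)
      fix i assume i: "0 < i" "i \<in> I"
      then have "newton_polygon f 0 < newton_polygon f (real i)"
        by (intro strict_mono_onD[OF mono]) (auto simp: I_def)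
      with NP_0 NP_le[OF i(2)] show "w 0 < w i" by linarith
    qed
  next
    assume w: "\<forall>i>0. i \<in> I \<longrightarrow> w 0 < w i"
    show "strict_mono_on {0..real n} (newton_polygon f)"
    proof (rule strict_mono_onI)
      fix x y assume xy: "x \<in> {0..real n}" "y \<in> {0..real n}" "x < y"
      \<comment> \<open>The least slope from the first point to another one. The additional 1 covers
        the case that there is no other point.\<close>
      define e where "e = Min (insert 1 ((\<lambda>i. (w i - w 0) / real i) ` (I - {0})))"
      have "0 < e" unfolding e_def using w finI by (subst Min_gr_iff) auto
      have slope: "w 0 + e * real i \<le> w i" if "i \<in> I" for i
      proof (cases "i = 0")
        case False
        then have "e \<le> (w i - w 0) / real i" unfolding e_def using that finI by (intro Min_le) auto
        then show ?thesis using False by (simp add: field_simps)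
      qed simp
      have "V y \<noteq> {}"
        using segment[of "y / real n" "w n" "real n"] pt[OF In] xy by (cases "n = 0") auto
      moreover have "newton_polygon f x + e * (y - x) \<le> v" if v: "v \<in> V y" for v
      proof -
        obtain c where c: "\<forall>i. c i \<ge> 0" "(\<Sum>i\<in>I. c i) = 1" "(\<Sum>i\<in>I. c i * real i) = y" "v = (\<Sum>i\<in>I. c i * w i)"
          using v by (auto simp: V_def)
        have v_ge: "w 0 + e * y \<le> v"
          unfolding c(4) using finI c slope by (intro newton_slope_bound) auto
        \<comment> \<open>The segment from the first point to \<open>(y, v)\<close> passes over
          \<open>x\<close> at this parameter; \<open>y\<close> is positive because
          \<open>0 \<le> x < y\<close>.\<close>
        define s where "s = x / y"
        have s: "0 \<le> s" "s \<le> 1" "s * y = x" using xy by (auto simp: s_def)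
        have "newton_polygon f x \<le> (1 - s) * w 0 + s * v"
          unfolding NP using segment[OF s(1,2) v] s(3) bdd by (intro cInf_lower) auto
        moreover have "(1 - s) * (w 0 + e * y) \<le> (1 - s) * v"
          using v_ge s by (intro mult_left_mono) auto
        moreover have "(1 - s) * (w 0 + e * y) = (1 - s) * w 0 + e * (y - x)"
          by (simp add: algebra_simps flip: s(3))
        moreover have "(1 - s) * v + s * v = v" by (simp add: algebra_simps)
        ultimately show ?thesis by linarith
      qed
      ultimately have "newton_polygon f x + e * (y - x) \<le> newton_polygon f y"
        unfolding NP[of y] by (intro cInf_greatest)
      moreover have "0 < e * (y - x)" using \<open>0 < e\<close> xy by simp
      ultimately show "newton_polygon f x < newton_polygon f y" by linarith
    qed
  qed
  then show ?thesis using False by (simp add: NP_positive_slopes_def n_def[symmetric] I_iff w_def)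
qed (simp add: NP_positive_slopes_def)

lemma ls_val_lcoeff:
  assumes "lfil m a" "lcoeff a m \<noteq> 0"
  shows "ls_val (lcoeff a) = m"
  unfolding ls_val_def using assms by (intro Least_equality) (auto simp: lfil_def intro: leI)

lemma dominated_iff_ls_val:
  "dominated f \<longleftrightarrow> coeff f 0 \<noteq> 0 \<and> (\<forall>i>0. coeff f i \<noteq> 0 \<longrightarrow> ls_val (lcoeff (coeff f 0)) < ls_val (lcoeff (coeff f i)))"
proof (cases "coeff f 0 = 0")
  case False
  obtain m where m: "lfil m (coeff f 0)" "lcoeff (coeff f 0) m \<noteq> 0" using False by (rule lfil_lead)
  have "dominated f \<longleftrightarrow> (\<forall>i>0. lfil (m + 1) (coeff f i))"
  proof
    assume "dominated f"
    then obtain m' where "lfil m' (coeff f 0)" "lcoeff (coeff f 0) m' \<noteq> 0" "\<forall>i>0. lfil (m' + 1) (coeff f i)"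
      by (auto simp: dominated_def)
    then show "\<forall>i>0. lfil (m + 1) (coeff f i)" using ls_val_lcoeff m by metis
  qed (use m in \<open>auto simp: dominated_def\<close>)
  moreover have "lfil (m + 1) (coeff f i) \<longleftrightarrow> (coeff f i \<noteq> 0 \<longrightarrow> m < ls_val (lcoeff (coeff f i)))" for i
  proof (cases "coeff f i = 0")
    case False
    obtain l where l: "lfil l (coeff f i)" "lcoeff (coeff f i) l \<noteq> 0" using False by (rule lfil_lead)
    then show ?thesis using False by (auto simp: ls_val_lcoeff[OF l] lfil_def) (meson le_less_linear less_le_trans zless_add1_eq)
  qed (simp add: lfil_zero)
  ultimately show ?thesis using False by (simp add: ls_val_lcoeff[OF m])
qed (simp add: dominated_def ls_zero_def)

section \<open>The Frobenius automorphism\<close>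

text \<open>Translation by \<open>x\<close> permutes the finite set \<open>H\<close>, so the sum of
  its elements does not change.\<close>

lemma card_mult_eq_0:
  fixes x :: "'k::field"
  assumes "finite H" "\<And>y. y \<in> H \<Longrightarrow> x + y \<in> H"
  shows "of_nat (card H) * x = 0"
proof -
  have "(+) x ` H = H"
    using assms by (intro endo_inj_surj) auto
  then have "(\<Sum>y\<in>H. y) = (\<Sum>y\<in>H. x + y)"
    using sum.reindex[of "(+) x" H "\<lambda>y. y"] by simp
  then show ?thesis by (simp add: sum.distrib)
qed

text \<open>For a prime divisor \<open>r\<close> of \<open>q\<close>, Sylow's theorem gives a
  subgroup of order \<open>r\<close> in the additive group of \<open>F\<close>. Its nonzero elements
  are killed by \<open>r\<close>, whence \<open>r\<close> is the characteristic.\<close>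

lemma card_Fq_subfield_prime_power:
  fixes F :: "'k::field set"
  assumes "is_Fq_subfield F q"
  shows "prime CHAR('k)" "\<exists>n. q = CHAR('k) ^ n"
proof -
  define G where "G = \<lparr>carrier = F, monoid.mult = (+), one = 0 :: 'k\<rparr>"
  have F: "finite F" "card F = q" "0 \<in> F" "1 \<in> F" "\<And>x y. x \<in> F \<Longrightarrow> y \<in> F \<Longrightarrow> x + y \<in> F" "\<And>x. x \<in> F \<Longrightarrow> - x \<in> F"
    using assms by (auto simp: is_Fq_subfield_def)
  interpret group G
  proof (rule groupI)
    show "\<exists>y\<in>carrier G. y \<otimes>\<^bsub>G\<^esub> x = \<one>\<^bsub>G\<^esub>" if "x \<in> carrier G" for x
      using that F(6) by (auto simp: G_def intro!: bexI[of _ "- x"])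
  qed (use F in \<open>auto simp: G_def add.assoc\<close>)
  have "order G = q" using F by (simp add: order_def G_def)
  have "q > 0" using F by (metis card_gt_0_iff empty_iff)
  have "of_nat q = (0 :: 'k)"
    using card_mult_eq_0[of F 1] F by simp
  then have "CHAR('k) > 0" using \<open>q > 0\<close> CHAR_pos_iff by blast
  then show p: "prime CHAR('k)" by (rule prime_CHAR_semidom)
  have only: "r = CHAR('k)" if r: "prime r" "r dvd q" for r
  proof (rule ccontr)
    assume "r \<noteq> CHAR('k)"
    obtain m where "q = r ^ 1 * m" using r(2) by auto
    then obtain H where H: "subgroup H G" "card H = r ^ 1"
      using sylow_thm[OF r(1) is_group, of 1 m] F(1) \<open>order G = q\<close> by (auto simp: G_def)
    have "card H > 1" using H(2) prime_gt_1_nat[OF r(1)] by simp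
    then have "\<not> H \<subseteq> {0}" using card_mono[of "{0 :: 'k}" H] by auto
    then obtain x where x: "x \<in> H" "x \<noteq> 0" by blast
    have "finite H" using \<open>card H > 1\<close> by (simp add: card_ge_0_finite)
    then have "of_nat r * x = 0"
      using card_mult_eq_0[of H x] subgroup.m_closed[OF H(1) x(1)] H(2) by (simp add: G_def)
    then have "CHAR('k) dvd r" using x(2) by (simp add: of_nat_eq_0_iff_char_dvd)
    then show False using p r(1) \<open>r \<noteq> CHAR('k)\<close> primes_dvd_imp_eq by blast
  qed
  obtain m where m: "q = CHAR('k) ^ multiplicity CHAR('k) q * m" "\<not> CHAR('k) dvd m"
    using multiplicity_decompose'[of q "CHAR('k)"] \<open>q > 0\<close> p by auto
  have "m = 1"
  proof (rule ccontr)
    assume "m \<noteq> 1"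
    then obtain r where r: "prime r" "r dvd m" using prime_factor_nat by blast
    then have "r dvd q" by (subst m(1)) (rule dvd_mult)
    then show False using only[OF r(1)] r(2) m(2) by simp
  qed
  then show "\<exists>n. q = CHAR('k) ^ n" using m(1) by auto
qed

text \<open>Surjectivity is inherited from the \<open>CHAR('k)\<close>-th power map, of which this
  is an iterate. Injectivity follows from additivity, as a field has no nilpotent elements besides
  0.\<close>

lemma frobenius_field_perfect:
  fixes F :: "'k::field set"
  assumes "is_Fq_subfield F q" "perfect_field TYPE('k)"
  shows "frobenius_field TYPE('k) q"
proof
  obtain n where n: "q = CHAR('k) ^ n" using card_Fq_subfield_prime_power(2)[OF assms(1)] by blast
  have p: "prime CHAR('k)" using assms(1) by (rule card_Fq_subfield_prime_power)
  show add: "frobq q (x + y) = frobq q x + frobq q y" for x y :: 'k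
    unfolding frobq_def by (rule freshmans_dream'[OF p n])
  have "surj (\<lambda>x :: 'k. x ^ CHAR('k))"
    using assms(2) p by (auto simp: perfect_field_def)
  then have "surj (\<lambda>x :: 'k. x ^ CHAR('k) ^ n)"
  proof (induction n)
    case (Suc n)
    have "(\<lambda>x :: 'k. x ^ CHAR('k) ^ Suc n) = (\<lambda>x. x ^ CHAR('k) ^ n) \<circ> (\<lambda>x. x ^ CHAR('k))"
      by (auto simp: fun_eq_iff power_mult)
    then show ?case using Suc comp_surj[of "\<lambda>x :: 'k. x ^ CHAR('k)"] by metis
  qed (simp add: surj_def)
  moreover have "inj (frobq q :: 'k \<Rightarrow> 'k)"
  proof (rule injI)
    fix x y :: 'k assume "frobq q x = frobq q y"
    moreover have "frobq q x = frobq q (x - y) + frobq q y" using add[of "x - y" y] by simp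
    ultimately have "(x - y) ^ q = 0" by (simp add: frobq_def)
    then show "x = y" using power_eq_0_iff[of "x - y" q] by simp
  qed
  ultimately show "bij (frobq q :: 'k \<Rightarrow> 'k)"
    by (auto simp: bij_def frobq_def[abs_def] n)
qed

section \<open>Both finiteness conditions in terms of the last invariant factor\<close>

context frobenius_field
begin

lemma abelian_iff_dominated:
  assumes "nring.equivalent (S.mm d) (S.mone d) (L.charm (\<lambda>i j. emb (D i j :: 'k poly))) B"
    "\<And>i j. i < d \<Longrightarrow> j < d \<Longrightarrow> B i j = (if i = j then c i else 0)"
    "\<And>i. i < d \<Longrightarrow> \<exists>h. c (d - 1) = L.pmul h (c i)" "0 < d"
  shows "abelian q d D \<longleftrightarrow> dominated (c (d - 1))"
proof -
  interpret mat: fring "S.mm d" "S.mone d" "S.mfil d" by (rule S.mat_fring)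
  have "abelian q d D \<longleftrightarrow> L.contracting d (\<lambda>i j. emb (D i j))"
    unfolding abelian_iff using L.contracting_if_fin_gen L.fin_gen_if_contracting lpol_emb by blast
  also have "\<dots> \<longleftrightarrow> mat.good (L.charm (\<lambda>i j. emb (D i j)))"
    by (rule L.contracting_iff_good)
  also have "\<dots> \<longleftrightarrow> mat.good B"
    using assms(1) mat.good_equivalent mat.equivalent_sym by blast
  also have "\<dots> \<longleftrightarrow> mat.good (S.diagm d c)"
    using assms(2) by (intro S.mat_good_cong) (simp add: S.diagm_def)
  also have "\<dots> \<longleftrightarrow> S.good (c (d - 1))"
    using assms(4,3) by (rule S.mat_good_diagm)
  finally show ?thesis by (simp only: good_iff_dominated)
qed

text \<open>The argument for \<open>abelian\<close> repeated over the opposite ring with all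
  matrices transposed; left divisors of the last factor become right divisors there.\<close>

lemma t_finite_iff_dominated:
  assumes "nring.equivalent (S.mm d) (S.mone d) (L.charm (\<lambda>i j. emb (D i j :: 'k poly))) B"
    "\<And>i j. i < d \<Longrightarrow> j < d \<Longrightarrow> B i j = (if i = j then c i else 0)"
    "\<And>i. i < d \<Longrightarrow> \<exists>h. c (d - 1) = L.pmul (c i) h" "0 < d"
  shows "t_finite q d D \<longleftrightarrow> dominated (c (d - 1))"
proof -
  interpret SR: fring R.pmul "[:lsingle 0 1 :: 'k laurent:]" "\<lambda>n f. \<forall>i. lfil n (coeff f i)"
    by (rule R.poly_fring)
  interpret mat: fring "SR.mm d" "S.mone d" "S.mfil d" by (rule SR.mat_fring)
  have pmul: "R.pmul = (\<lambda>f g. L.pmul g f)" by (intro ext L.pmul_opposite)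
  have "t_finite q d D \<longleftrightarrow> R.contracting d (\<lambda>i j. emb (D j i))"
    unfolding t_finite_iff using R.contracting_if_fin_gen R.fin_gen_if_contracting lpol_emb by blast
  also have "\<dots> \<longleftrightarrow> mat.good (R.charm (\<lambda>i j. emb (D j i)))"
    by (rule R.contracting_iff_good)
  also have "R.charm (\<lambda>i j. emb (D j i)) = (\<lambda>i j. L.charm (\<lambda>i j. emb (D i j)) j i)"
    by (auto simp: L.charm_def fun_eq_iff)
  also have "mat.good \<dots> \<longleftrightarrow> mat.good (\<lambda>i j. B j i)"
    using S.equivalent_transpose[OF assms(1)] mat.good_equivalent mat.equivalent_sym
    unfolding pmul by blast
  also have "\<dots> \<longleftrightarrow> mat.good (SR.diagm d c)"
    using assms(2) by (intro SR.mat_good_cong) (simp add: SR.diagm_def)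
  also have "\<dots> \<longleftrightarrow> SR.good (c (d - 1))"
    using assms(4,3) unfolding pmul[symmetric] by (intro SR.mat_good_diagm) (auto simp: pmul)
  finally show ?thesis by (simp only: good_opposite_iff_dominated)
qed

end

theorem theorem6p6:
  fixes F :: "'k::field set" and q :: nat and \<theta> :: 'k and d :: nat
    and D :: "'k skmat" and lam :: "'k lp"
  assumes "is_Fq_subfield F q"
    and "perfect_field TYPE('k)"
    and "0 < d"
    and "is_t_module F q \<theta> d D"
    and "last_invariant_factor q d D lam"
  shows "(abelian q d D \<longleftrightarrow> t_finite q d D) \<and> (t_finite q d D \<longleftrightarrow> NP_positive_slopes lam)"
proof -
  interpret frobenius_field q "TYPE('k)"
    using assms(1,2) by (rule frobenius_field_perfect)
  obtain B c where *: "nring.equivalent (S.mm d) (S.mone d) (L.charm (\<lambda>i j. emb (D i j))) B"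
    "\<And>i j. i < d \<Longrightarrow> j < d \<Longrightarrow> B i j = (if i = j then c i else 0)"
    "\<And>i. i < d \<Longrightarrow> \<exists>h. c (d - 1) = L.pmul h (c i)"
    "\<And>i. i < d \<Longrightarrow> \<exists>h. c (d - 1) = L.pmul (c i) h"
    and lam: "lam = lrep (c (d - 1))"
    using last_invariant_factor_obtain[OF assms(5,3)] by blast
  have "lp_monic lam"
    using assms(3,5) by (auto simp: last_invariant_factor_def)
  then have "NP_positive_slopes lam \<longleftrightarrow> dominated (c (d - 1))"
    by (simp add: NP_positive_slopes_iff dominated_iff_ls_val lam lrep_def)
  then show ?thesis
    using abelian_iff_dominated[OF *(1-3) assms(3)] t_finite_iff_dominated[OF *(1,2,4) assms(3)] by blast
qed

end
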